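(* Let $X,Y$ be completely regular spaces and $E,F$ normed spaces over $\mathbb K$. Assume that one of the following holds. (Situation 2) $A\subset C(X)$ and $B\subset C(Y)$ are normal local subrings, $A(X,E)\subset C(X,E)$ is an $A$-module, $A(Y,F)\subset C(Y,F)$ is a $B$-module, for every $x\in X$ there is $f\in A(X,E)$ with $f(x)\neq0$, and for every $y\in Y$ there is $g\in A(Y,F)$ with $g(y)\ne0$. (Situation 3) $E$ and $F$ are infinite-dimensional, $A(X,E)=C^*(X,E)$ and $A(Y,F)=C^*(Y,F)$. If there is a biseparating map $T:A(X,E)\to A(Y,F)$, then the realcompactifications $\upsilon X$ and $\upsilon Y$ are homeomorphic.
   Context: $\mathbb K=\mathbb R$ or $\mathbb C$. Completely regular spaces are Hausdorff. $C(X,E)$ (resp. $C^*(X,E)$) is the space of continuous (resp. bounded continuous) functions $X\to E$; $C(X)=C(X,\mathbb K)$. For $f\in C(X,E)$, $c(f):=\{x\in X:f(x)\ne0\}$. For $f\in C(X)$, $f^{\beta X}:\beta X\to\mathbb K\cup\{\infty\}$ (one-point compactification) is its continuous extension to the Stone-Čech compactification. $\upsilon X$ is the (Hewitt) realcompactification of $X$. A subring $A\subset C(X)$ is normal if for any two disjoint closed $K,L\subset\beta X$ there is $f\in A$ with $0\le f\le1$, $f^{\beta X}\equiv1$ on $K$ and $f^{\beta X}\equiv0$ on $L$. It is local if $f\in C(X)$ belongs to $A$ whenever for every $x\in X$ there exist an open neighborhood $U(x)$ of $x$ and $f_x\in A$ with $f\equiv f_x$ on $U(x)$. An $A$-module $A(X,E)\subset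 C(X,E)$ is an additive subgroup closed under pointwise multiplication by elements of $A$. A map $T:A(X,E)\to A(Y,F)$ is separating if it is additive and $c(Tf)\cap c(Tg)=\emptyset$ whenever $c(f)\cap c(g)=\emptyset$; it is biseparating if it is bijective and both $T$ and $T^{-1}$ are separating. Linearity is not assumed. *)

theory Defs
  imports "HOL-Analysis.Analysis"
begin

section \<open>The scalar field and normed spaces over it\<close>

text \<open>The class contains exactly the isometric copies of the real and of the complex numbers.\<close>

class real_or_complex = real_normed_field +
  assumes real_or_complex:
    "\<exists>\<phi> :: 'a \<Rightarrow> complex.
       (\<forall>x y. \<phi> (x + y) = \<phi> x + \<phi> y) \<and> (\<forall>x y. \<phi> (x * y) = \<phi> x * \<phi> y) \<and>
       (\<forall>r x. \<phi> (r *\<^sub>R x) = r *\<^sub>R \<phi> x) \<and> (\<forall>x. norm (\<phi> x) = norm x) \<and>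
       (range \<phi> = \<real> \<or> range \<phi> = UNIV)"

instance real :: real_or_complex
proof
  show "\<exists>\<phi> :: real \<Rightarrow> complex.
       (\<forall>x y. \<phi> (x + y) = \<phi> x + \<phi> y) \<and> (\<forall>x y. \<phi> (x * y) = \<phi> x * \<phi> y) \<and>
       (\<forall>r x. \<phi> (r *\<^sub>R x) = r *\<^sub>R \<phi> x) \<and> (\<forall>x. norm (\<phi> x) = norm x) \<and>
       (range \<phi> = \<real> \<or> range \<phi> = UNIV)"
    by (rule exI[of _ of_real]) (simp add: Reals_def scaleR_conv_of_real)
qed

instance complex :: real_or_complex
proof
  show "\<exists>\<phi> :: complex \<Rightarrow> complex.
       (\<forall>x y. \<phi> (x + y) = \<phi> x + \<phi> y) \<and> (\<forall>x y. \<phi> (x * y) = \<phi> x * \<phi> y) \<and>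
       (\<forall>r x. \<phi> (r *\<^sub>R x) = r *\<^sub>R \<phi> x) \<and> (\<forall>x. norm (\<phi> x) = norm x) \<and>
       (range \<phi> = \<real> \<or> range \<phi> = UNIV)"
    by (rule exI[of _ id]) simp
qed

text \<open>A normed space over the scalar field is a real normed space whose real scalar
  multiplication is the restriction of the given one.\<close>

locale normed_space_over = vector_space smul
  for smul :: "'k::real_or_complex \<Rightarrow> 'e::real_normed_vector \<Rightarrow> 'e" +
  assumes scale_of_real: "smul (of_real r) v = r *\<^sub>R v"
    and norm_scale: "norm (smul a v) = norm a * norm v"

definition infinite_dimensional ::
    "('k::field \<Rightarrow> 'e::ab_group_add \<Rightarrow> 'e) \<Rightarrow> bool" where
  "infinite_dimensional smul \<longleftrightarrow> (\<nexists>Basis. finite_dimensional_vector_space smul Basis)"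


section \<open>Spaces of continuous functions\<close>

text \<open>A function on the space \<^term>\<open>X\<close> is represented by its extension by zero to the whole
  type, so that equality and the pointwise operations are those of the ambient function type.\<close>

definition cont_funs :: "'a topology \<Rightarrow> ('a \<Rightarrow> 'e::real_normed_vector) set" where
  "cont_funs X = {f. continuous_map X euclidean f \<and> (\<forall>x. x \<notin> topspace X \<longrightarrow> f x = 0)}"

definition bounded_cont_funs :: "'a topology \<Rightarrow> ('a \<Rightarrow> 'e::real_normed_vector) set" where
  "bounded_cont_funs X = {f \<in> cont_funs X. bounded (f ` topspace X)}"

definition cozero :: "'a topology \<Rightarrow> ('a \<Rightarrow> 'e::real_normed_vector) \<Rightarrow> 'a set" where
  "cozero X f = {x \<in> topspace X. f x \<noteq> 0}"


section \<open>Stone-Cech compactification and realcompactification\<close>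

text \<open>The compactification is the closure of the image of the canonical map into the
  cube indexed by all continuous functions into the unit interval.\<close>

definition unit_funs :: "'a topology \<Rightarrow> ('a \<Rightarrow> real) set" where
  "unit_funs X = {f \<in> cont_funs X. f ` topspace X \<subseteq> {0..1}}"

definition unit_cube :: "'a topology \<Rightarrow> (('a \<Rightarrow> real) \<Rightarrow> real) topology" where
  "unit_cube X = product_topology (\<lambda>f. top_of_set {0..1}) (unit_funs X)"

definition stone_cech_emb :: "'a topology \<Rightarrow> 'a \<Rightarrow> ('a \<Rightarrow> real) \<Rightarrow> real" where
  "stone_cech_emb X x = (\<lambda>f\<in>unit_funs X. f x)"

definition stone_cech :: "'a topology \<Rightarrow> (('a \<Rightarrow> real) \<Rightarrow> real) topology" where
  "stone_cech X =
     subtopology (unit_cube X) (unit_cube X closure_of (stone_cech_emb X ` topspace X))"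

text \<open>In the one-point compactification of the scalars, \<^term>\<open>None\<close> is the point at infinity.\<close>

definition is_beta_extension ::
    "'a topology \<Rightarrow> ('a \<Rightarrow> 'k::real_normed_vector) \<Rightarrow> ((('a \<Rightarrow> real) \<Rightarrow> real) \<Rightarrow> 'k option) \<Rightarrow> bool" where
  "is_beta_extension X f g \<longleftrightarrow>
     g \<in> extensional (topspace (stone_cech X)) \<and>
     continuous_map (stone_cech X) (Alexandroff_compactification euclidean) g \<and>
     (\<forall>x\<in>topspace X. g (stone_cech_emb X x) = Some (f x))"

definition beta_extension ::
    "'a topology \<Rightarrow> ('a \<Rightarrow> 'k::real_normed_vector) \<Rightarrow> (('a \<Rightarrow> real) \<Rightarrow> real) \<Rightarrow> 'k option" where
  "beta_extension X f = (THE g. is_beta_extension X f g)"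

lemma stone_cech_emb_in_cube:
  "stone_cech_emb X ` topspace X \<subseteq> topspace (unit_cube X)"
  unfolding stone_cech_emb_def unit_cube_def unit_funs_def
  by (simp add: image_subset_iff PiE_iff)

lemma topspace_stone_cech:
  "topspace (stone_cech X) = unit_cube X closure_of (stone_cech_emb X ` topspace X)"
  unfolding stone_cech_def topspace_subtopology
  using closure_of_subset_topspace by (rule Int_absorb1)

lemma stone_cech_dense:
  "stone_cech X closure_of (stone_cech_emb X ` topspace X) = topspace (stone_cech X)"
proof -
  have "stone_cech_emb X ` topspace X \<subseteq> unit_cube X closure_of (stone_cech_emb X ` topspace X)"
    using stone_cech_emb_in_cube by (rule closure_of_subset)
  then show ?thesis
    unfolding topspace_stone_cech unfolding stone_cech_def closure_of_subtopology
    by (simp add: Int_absorb1)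
qed

lemma compact_space_stone_cech: "compact_space (stone_cech X)"
proof -
  have "compact_space (unit_cube X)"
    unfolding unit_cube_def by (simp add: compact_space_product_topology compact_space_subtopology)
  then show ?thesis
    unfolding stone_cech_def by (simp add: compact_space_subtopology closedin_compact_space)
qed

lemma Hausdorff_space_stone_cech: "Hausdorff_space (stone_cech X)"
  unfolding stone_cech_def unit_cube_def
  by (simp add: Hausdorff_space_subtopology Hausdorff_space_product_topology)

lemma stone_cech_extension:
  fixes Z :: "'z topology"
  assumes "compact_space Z" "Hausdorff_space Z" "continuous_map X Z h"
  shows "\<exists>g. continuous_map (stone_cech X) Z g \<and> (\<forall>x\<in>topspace X. g (stone_cech_emb X x) = h x)"
proof -
  have "completely_regular_space Z"
    using assms compact_Hausdorff_or_regular_imp_normal_space normal_imp_completely_regular_space by blast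
  then obtain K :: "('z \<Rightarrow> real) set" and e where
     e: "embedding_map Z (product_topology (\<lambda>f. top_of_set {0..1::real}) K) e"
    using completely_regular_space_cube_embedding assms by blast
  define Q where "Q = product_topology (\<lambda>f. top_of_set {0..1::real}) K"
  have e: "embedding_map Z Q e" using e Q_def by simp
  have ce: "continuous_map Z Q e"
    using e by (simp add: embedding_map_def homeomorphic_imp_continuous_map continuous_map_in_subtopology
        homeomorphic_eq_everything_map)
  define u where "u k = (\<lambda>x. if x \<in> topspace X then e (h x) k else 0)" for k
  have ck: "continuous_map X (top_of_set {0..1}) (\<lambda>x. e (h x) k)" if "k \<in> K" for k
  proof -
    have "continuous_map X Q (e \<circ> h)" using ce assms continuous_map_compose by blast
    then show ?thesis using that unfolding Q_def by (auto simp: continuous_map_componentwise o_def)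
  qed
  have u: "u k \<in> unit_funs X" if "k \<in> K" for k
  proof -
    have "continuous_map X (top_of_set {0..1}) (u k)"
      using continuous_map_eq[OF ck[OF that], of "u k"] by (simp add: u_def)
    then show ?thesis
      by (auto simp: unit_funs_def cont_funs_def continuous_map_in_subtopology u_def image_subset_iff Pi_iff)
  qed
  define G where "G p = (\<lambda>k\<in>K. p (u k))" for p :: "('a \<Rightarrow> real) \<Rightarrow> real"
  have cG: "continuous_map (unit_cube X) Q G"
    unfolding Q_def G_def unit_cube_def
    using u by (auto simp: continuous_map_componentwise intro!: continuous_map_product_projection)
  have Ge: "G (stone_cech_emb X x) = e (h x)" if "x \<in> topspace X" for x
  proof -
    have "h x \<in> topspace Z" using assms that by (meson continuous_map_image_subset_topspace image_subset_iff)
    then have "e (h x) \<in> topspace Q" using ce by (meson continuous_map_image_subset_topspace image_subset_iff)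
    then show ?thesis using that u
      unfolding G_def Q_def stone_cech_emb_def by (auto simp: u_def PiE_iff extensional_def fun_eq_iff)
  qed
  have cl: "closedin Q (e ` topspace Z)"
    by (rule compactin_imp_closedin)
      (use assms ce in \<open>auto simp: Q_def Hausdorff_space_product_topology Hausdorff_space_subtopology compact_space_def intro!: image_compactin[of Z]\<close>)
  have Gim: "G ` topspace (stone_cech X) \<subseteq> e ` topspace Z"
  proof -
    have "G ` topspace (stone_cech X) \<subseteq> Q closure_of (G ` (stone_cech_emb X ` topspace X))"
      unfolding topspace_stone_cech using cG by (rule continuous_map_image_closure_subset)
    also have "\<dots> \<subseteq> e ` topspace Z"
      by (rule closure_of_minimal[OF _ cl])
         (use Ge assms in \<open>auto simp: continuous_map_def\<close>)
    finally show ?thesis .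
  qed
  obtain e' where e': "homeomorphic_maps Z (subtopology Q (e ` topspace Z)) e e'"
    using e unfolding embedding_map_def homeomorphic_map_maps by blast
  have "continuous_map (stone_cech X) (subtopology Q (e ` topspace Z)) G"
    using Gim cG unfolding continuous_map_in_subtopology stone_cech_def
    by (auto intro: continuous_map_from_subtopology)
  then have "continuous_map (stone_cech X) Z (e' \<circ> G)"
    using e' unfolding homeomorphic_maps_def by (blast intro: continuous_map_compose)
  moreover have "(e' \<circ> G) (stone_cech_emb X x) = h x" if "x \<in> topspace X" for x
    using Ge[OF that] e' assms(3) that unfolding homeomorphic_maps_def
    by (auto simp: continuous_map_def)
  ultimately show ?thesis by blast
qed

lemma locally_compact_space_scalars:
  "locally_compact_space (euclidean :: 'k::real_or_complex topology)"
proof -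
  obtain \<phi> :: "'k \<Rightarrow> complex" where add: "\<And>x y. \<phi> (x + y) = \<phi> x + \<phi> y"
    and nrm: "\<And>x. norm (\<phi> x) = norm x" and rng: "range \<phi> = \<real> \<or> range \<phi> = UNIV"
    using real_or_complex[where 'a='k] by blast
  have "\<phi> (x - y) = \<phi> x - \<phi> y" for x y
    using add[of "x - y" y] by simp
  then have dst: "dist (\<phi> x) (\<phi> y) = dist x y" for x y
    by (metis dist_norm nrm)
  then have inj: "inj \<phi>" by (intro injI) (metis dist_eq_0_iff)
  have cont: "continuous_on (range \<phi>) (inv \<phi>)"
    unfolding continuous_on_iff by (auto simp: dst inj)
  have "closed (range \<phi>)"
    using rng closed_complex_Reals by auto
  have "compact (inv \<phi> ` (range \<phi> \<inter> cball (\<phi> x) 1))" for x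
  proof (rule compact_continuous_image)
    show "continuous_on (range \<phi> \<inter> cball (\<phi> x) 1) (inv \<phi>)"
      by (rule continuous_on_subset[OF cont]) blast
    show "compact (range \<phi> \<inter> cball (\<phi> x) 1)"
      using \<open>closed (range \<phi>)\<close> by (rule closed_Int_compact) (rule compact_cball)
  qed
  moreover have "inv \<phi> ` (range \<phi> \<inter> cball (\<phi> x) 1) = cball x 1" for x
  proof -
    have "range \<phi> \<inter> cball (\<phi> x) 1 = \<phi> ` cball x 1"
      by (auto simp: dst)
    then show ?thesis using inj by (simp add: image_comp)
  qed
  ultimately have "compact (cball x 1)" for x :: 'k by metis
  then have "openin euclidean (ball x 1) \<and> compactin euclidean (cball x 1) \<and>
      x \<in> ball x 1 \<and> ball x 1 \<subseteq> cball x 1" for x :: 'k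
    by (simp add: open_openin[symmetric] ball_subset_cball)
  then show ?thesis
    unfolding locally_compact_space_def by blast
qed

lemma ex1_is_beta_extension:
  fixes f :: "'a \<Rightarrow> 'k::real_or_complex"
  assumes "continuous_map X euclidean f"
  shows "\<exists>!g. is_beta_extension X f g"
proof -
  let ?Z = "Alexandroff_compactification (euclidean :: 'k topology)"
  have H: "Hausdorff_space ?Z" using locally_compact_space_scalars by (simp add: Hausdorff_space_Alexandroff_compactification)
  have c: "continuous_map X ?Z (Some \<circ> f)"
    using assms continuous_map_Some continuous_map_compose by blast
  obtain g where g: "continuous_map (stone_cech X) ?Z g" 
      "\<forall>x\<in>topspace X. g (stone_cech_emb X x) = (Some \<circ> f) x"
    using stone_cech_extension[OF compact_space_Alexandroff_compactification H c] by blast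
  have sub: "stone_cech_emb X ` topspace X \<subseteq> topspace (stone_cech X)"
    by (simp add: topspace_stone_cech closure_of_subset stone_cech_emb_in_cube)
  show ?thesis
  proof (rule ex1I[of _ "restrict g (topspace (stone_cech X))"])
    show "is_beta_extension X f (restrict g (topspace (stone_cech X)))"
      using g sub continuous_map_eq[OF g(1), of "restrict g (topspace (stone_cech X))"] by (auto simp: is_beta_extension_def)
  next
    fix g' assume g': "is_beta_extension X f g'"
    have "g' p = g p" if "p \<in> topspace (stone_cech X)" for p
      by (rule forall_in_closure_of_eq[OF _ H, of p "stone_cech X" "stone_cech_emb X ` topspace X"])
         (use that g g' in \<open>auto simp: stone_cech_dense is_beta_extension_def\<close>)
    then show "g' = restrict g (topspace (stone_cech X))"
      using g' by (auto simp: is_beta_extension_def extensional_def fun_eq_iff)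
  qed
qed

text \<open>The Hewitt realcompactification: the points of the Stone-Cech compactification at which the
  extension of every real-valued continuous function is finite.\<close>

definition realcompactification :: "'a topology \<Rightarrow> (('a \<Rightarrow> real) \<Rightarrow> real) topology" where
  "realcompactification X =
     subtopology (stone_cech X)
       {p \<in> topspace (stone_cech X).
          \<forall>f \<in> (cont_funs X :: ('a \<Rightarrow> real) set). beta_extension X f p \<noteq> None}"


section \<open>Normal and local subrings, modules\<close>

text \<open>Subrings are not required to contain the unit.\<close>

definition is_subring :: "'a topology \<Rightarrow> ('a \<Rightarrow> 'k::real_normed_field) set \<Rightarrow> bool" where
  "is_subring X A \<longleftrightarrow>
     A \<subseteq> cont_funs X \<and> (\<lambda>x. 0) \<in> A \<and>
     (\<forall>f\<in>A. \<forall>g\<in>A. (\<lambda>x. f x - g x) \<in> A \<and> (\<lambda>x. f x * g x) \<in> A)"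

definition is_normal :: "'a topology \<Rightarrow> ('a \<Rightarrow> 'k::real_normed_field) set \<Rightarrow> bool" where
  "is_normal X A \<longleftrightarrow>
     (\<forall>K L. closedin (stone_cech X) K \<and> closedin (stone_cech X) L \<and> disjnt K L \<longrightarrow>
        (\<exists>f\<in>A. (\<forall>x\<in>topspace X. f x \<in> of_real ` {0..1}) \<and>
               (\<forall>p\<in>K. beta_extension X f p = Some 1) \<and>
               (\<forall>p\<in>L. beta_extension X f p = Some 0)))"

definition is_local :: "'a topology \<Rightarrow> ('a \<Rightarrow> 'k::real_normed_field) set \<Rightarrow> bool" where
  "is_local X A \<longleftrightarrow>
     (\<forall>f\<in>cont_funs X.
        (\<forall>x\<in>topspace X. \<exists>U. openin X U \<and> x \<in> U \<and> (\<exists>g\<in>A. \<forall>z\<in>U. f z = g z)) \<longrightarrow> f \<in> A)"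

definition is_module ::
    "'a topology \<Rightarrow> ('k::real_normed_field \<Rightarrow> 'e::real_normed_vector \<Rightarrow> 'e) \<Rightarrow>
     ('a \<Rightarrow> 'k) set \<Rightarrow> ('a \<Rightarrow> 'e) set \<Rightarrow> bool" where
  "is_module X smul A M \<longleftrightarrow>
     M \<subseteq> cont_funs X \<and> (\<lambda>x. 0) \<in> M \<and>
     (\<forall>f\<in>M. \<forall>g\<in>M. (\<lambda>x. f x - g x) \<in> M) \<and>
     (\<forall>a\<in>A. \<forall>f\<in>M. (\<lambda>x. smul (a x) (f x)) \<in> M)"


section \<open>Biseparating maps\<close>

definition separating ::
    "'a topology \<Rightarrow> 'b topology \<Rightarrow> ('a \<Rightarrow> 'e::real_normed_vector) set \<Rightarrow>
     ('b \<Rightarrow> 'f::real_normed_vector) set \<Rightarrow> (('a \<Rightarrow> 'e) \<Rightarrow> ('b \<Rightarrow> 'f)) \<Rightarrow> bool" where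
  "separating X Y M N T \<longleftrightarrow>
     T ` M \<subseteq> N \<and>
     (\<forall>f\<in>M. \<forall>g\<in>M. T (\<lambda>x. f x + g x) = (\<lambda>y. T f y + T g y)) \<and>
     (\<forall>f\<in>M. \<forall>g\<in>M. cozero X f \<inter> cozero X g = {} \<longrightarrow> cozero Y (T f) \<inter> cozero Y (T g) = {})"

definition biseparating ::
    "'a topology \<Rightarrow> 'b topology \<Rightarrow> ('a \<Rightarrow> 'e::real_normed_vector) set \<Rightarrow>
     ('b \<Rightarrow> 'f::real_normed_vector) set \<Rightarrow> (('a \<Rightarrow> 'e) \<Rightarrow> ('b \<Rightarrow> 'f)) \<Rightarrow> bool" where
  "biseparating X Y M N T \<longleftrightarrow>
     bij_betw T M N \<and> separating X Y M N T \<and> separating Y X N M (inv_into M T)"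

end

theory Submission
  imports Defs
begin

text \<open>Write \<open>\<beta>X\<close> for \<^term>\<open>stone_cech X\<close>. Since disjoint cozero sets go to disjoint cozero sets, for each
  \<open>y\<close> the functions \<open>f\<close> with \<open>T f y \<noteq> 0\<close> concentrate at a single point of \<open>\<beta>X\<close>; this gives a map
  \<open>h : \<beta>Y \<rightarrow> \<beta>X\<close>, and the analogous map for the inverse of \<open>T\<close> is its inverse. A point of \<open>\<beta>X\<close>
  lies outside the realcompactification iff some continuous \<open>\<Omega> : \<beta>X \<rightarrow> [0,1]\<close> that is positive on \<open>X\<close>
  vanishes there, so it suffices that \<open>\<Omega> \<circ> h\<close> is then positive on \<open>Y\<close>. Suppose \<open>\<Omega> (h y) = 0\<close>, and
  divide the range of \<open>\<Omega>\<close> into annuli shrinking to \<open>0\<close>.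

  For modules over local rings take \<open>f\<close> with \<open>T f y \<noteq> 0\<close>, supported in separated annuli, and let \<open>g\<close>
  be \<open>n f\<close> on the \<open>n\<close>-th annulus, where \<open>T g = n T f\<close> by additivity; then \<open>T g\<close> is unbounded near
  \<open>y\<close>. For bounded functions there is \<open>f\<close> such that \<open>T f\<close> is constantly \<open>v\<^sub>n\<close> on the \<open>n\<close>-th annulus,
  for a bounded separated sequence \<open>v\<close>, and \<open>T f\<close> is discontinuous at \<open>y\<close>. That such an \<open>f\<close> is
  bounded is a gliding hump argument.\<close>

section \<open>The canonical map into the Stone-Cech compactification\<close>

lemma stone_cech_emb_in: "x \<in> topspace X \<Longrightarrow> stone_cech_emb X x \<in> topspace (stone_cech X)"
  using closure_of_subset[OF stone_cech_emb_in_cube, of X] by (auto simp: topspace_stone_cech)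

lemma continuous_stone_cech_emb: "continuous_map X (stone_cech X) (stone_cech_emb X)"
proof -
  have "continuous_map X (top_of_set {0..1}) (\<lambda>x. stone_cech_emb X x f)" if "f \<in> unit_funs X" for f
    using that
    by (auto simp: stone_cech_emb_def unit_funs_def cont_funs_def continuous_map_in_subtopology)
  moreover have "stone_cech_emb X x \<in> extensional (unit_funs X)" for x
    by (simp add: stone_cech_emb_def)
  ultimately have "continuous_map X (unit_cube X) (stone_cech_emb X)"
    unfolding unit_cube_def by (auto simp: continuous_map_componentwise)
  then show ?thesis
    unfolding stone_cech_def continuous_map_in_subtopology
    using stone_cech_emb_in[of _ X] by (auto simp: topspace_stone_cech)
qed

lemma stone_cech_emb_meets_open:
  assumes "openin (stone_cech X) U" "p \<in> U"
  obtains x where "x \<in> topspace X" "stone_cech_emb X x \<in> U"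
proof -
  have "p \<in> stone_cech X closure_of (stone_cech_emb X ` topspace X)"
    using assms openin_subset by (auto simp: stone_cech_dense)
  then show ?thesis
    using assms that by (auto simp: in_closure_of)
qed

text \<open>Complete regularity enters here: a function that is 0 at \<open>x\<close> and 1 off
  \<open>V\<close> extends to \<beta>X, and \<open>U\<close> is the set where the extension is below
  1.\<close>

lemma stone_cech_neighbourhood:
  assumes "completely_regular_space X" "openin X V" "x \<in> V"
  obtains U where "openin (stone_cech X) U" "stone_cech_emb X x \<in> U"
    "\<And>z. z \<in> topspace X \<Longrightarrow> stone_cech_emb X z \<in> U \<Longrightarrow> z \<in> V"
proof -
  have x: "x \<in> topspace X - (topspace X - V)"
    using assms openin_subset by fastforce
  obtain f :: "'a \<Rightarrow> real" where f: "continuous_map X (top_of_set {0..1}) f" "f x = 0"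
      "f ` (topspace X - V) \<subseteq> {1}"
    using assms x unfolding completely_regular_space_def
    by (metis openin_closedin_eq closedin_def openin_subset double_diff order_refl)
  obtain g where g: "continuous_map (stone_cech X) (top_of_set {0..1}) g"
      "\<forall>x\<in>topspace X. g (stone_cech_emb X x) = f x"
    using stone_cech_extension[OF _ _ f(1)]
    by (auto simp: compact_space_subtopology Hausdorff_space_subtopology)
  have "continuous_map (stone_cech X) euclideanreal g"
    using g(1) continuous_map_in_subtopology by blast
  then have "openin (stone_cech X) {p \<in> topspace (stone_cech X). g p \<in> {..<1}}"
    by (rule openin_continuous_map_preimage) simp
  then show ?thesis
    using that[of "{p \<in> topspace (stone_cech X). g p \<in> {..<1}}"] x f g stone_cech_emb_in[of _ X]
    by fastforce
qed

lemma stone_cech_eqI: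
  assumes "Hausdorff_space Z" "continuous_map (stone_cech X) Z f" "continuous_map (stone_cech X) Z g"
    and "\<And>x. x \<in> topspace X \<Longrightarrow> f (stone_cech_emb X x) = g (stone_cech_emb X x)"
    and "p \<in> topspace (stone_cech X)"
  shows "f p = g p"
  by (rule forall_in_closure_of_eq[OF _ assms(1), of p "stone_cech X" "stone_cech_emb X ` topspace X"])
     (use assms in \<open>auto simp: stone_cech_dense\<close>)

lemma normal_space_stone_cech: "normal_space (stone_cech X)"
  using compact_space_stone_cech Hausdorff_space_stone_cech
  by (blast intro: compact_Hausdorff_or_regular_imp_normal_space)

text \<open>Truncated to [0, 1], \<open>\<phi>\<close> extends to \<beta>X, and the level sets of
  the extension at 1 and 0 are closed and disjoint. This turns thresholds of a possibly unbounded
  function on X into closed sets to which normality or \<open>split\<close> applies.\<close>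

lemma stone_cech_separation:
  fixes \<phi> :: "'a \<Rightarrow> real"
  assumes "continuous_map X euclideanreal \<phi>"
  obtains K L where "closedin (stone_cech X) K" "closedin (stone_cech X) L" "disjnt K L"
    "\<forall>x\<in>topspace X. (1 \<le> \<phi> x \<longrightarrow> stone_cech_emb X x \<in> K) \<and> (\<phi> x \<le> 0 \<longrightarrow> stone_cech_emb X x \<in> L)"
proof -
  have "continuous_map X euclideanreal (\<lambda>x. max 0 (min 1 (\<phi> x)))"
    by (intro continuous_intros assms)
  then have \<psi>: "continuous_map X (top_of_set {0..1}) (\<lambda>x. max 0 (min 1 (\<phi> x)))"
    by (auto simp: continuous_map_in_subtopology)
  obtain g where g: "continuous_map (stone_cech X) (top_of_set {0..1}) g"
      "\<forall>x\<in>topspace X. g (stone_cech_emb X x) = max 0 (min 1 (\<phi> x))"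
    using stone_cech_extension[OF _ _ \<psi>]
    by (auto simp: compact_space_subtopology Hausdorff_space_subtopology)
  have "continuous_map (stone_cech X) euclideanreal g"
    using g(1) continuous_map_in_subtopology by blast
  then have "closedin (stone_cech X) {p \<in> topspace (stone_cech X). g p \<in> {c}}" for c
    by (rule closedin_continuous_map_preimage) simp
  then show ?thesis
    using that[of "{p \<in> topspace (stone_cech X). g p \<in> {1}}" "{p \<in> topspace (stone_cech X). g p \<in> {0}}"]
      g(2) stone_cech_emb_in[of _ X]
    by (auto simp: disjnt_iff)
qed

section \<open>Support points\<close>

text \<open>Common ground of the two situations. The assumption \<open>split\<close> stands for
  multiplication by a cut-off function: for modules the factor comes from the normal ring, for
  bounded functions from Urysohn's lemma in \<beta>X.\<close>

locale splitting_space =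
  fixes X :: "'a topology" and M :: "('a \<Rightarrow> 'e::real_normed_vector) set"
  assumes completely_regular: "completely_regular_space X"
    and cont_funs: "M \<subseteq> cont_funs X"
    and zero: "(\<lambda>x. 0) \<in> M"
    and diff: "f \<in> M \<Longrightarrow> g \<in> M \<Longrightarrow> (\<lambda>x. f x - g x) \<in> M"
    and nonvanishing: "x \<in> topspace X \<Longrightarrow> \<exists>f\<in>M. f x \<noteq> 0"
    and split: "closedin (stone_cech X) K \<Longrightarrow> closedin (stone_cech X) L \<Longrightarrow> disjnt K L \<Longrightarrow> f \<in> M \<Longrightarrow>
      \<exists>g\<in>M. \<forall>x\<in>topspace X. (stone_cech_emb X x \<in> K \<longrightarrow> g x = f x) \<and>
        (stone_cech_emb X x \<in> L \<longrightarrow> g x = 0) \<and> (f x = 0 \<longrightarrow> g x = 0)"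
begin

lemma cont: "f \<in> M \<Longrightarrow> continuous_map X euclidean f"
  using cont_funs by (auto simp: cont_funs_def)

lemma outside: "f \<in> M \<Longrightarrow> x \<notin> topspace X \<Longrightarrow> f x = 0"
  using cont_funs by (auto simp: cont_funs_def)

lemma add: "f \<in> M \<Longrightarrow> g \<in> M \<Longrightarrow> (\<lambda>x. f x + g x) \<in> M"
  using diff[of f "\<lambda>x. 0 - g x"] diff[OF zero, of g] by simp

text \<open>The closure is taken in \<beta>X rather than in X, so that supports are compact.\<close>

definition support :: "('a \<Rightarrow> 'e) \<Rightarrow> (('a \<Rightarrow> real) \<Rightarrow> real) set" where
  "support f = stone_cech X closure_of (stone_cech_emb X ` cozero X f)"

lemma closedin_support: "closedin (stone_cech X) (support f)"
  by (simp add: support_def)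

lemma in_support: "x \<in> topspace X \<Longrightarrow> f x \<noteq> 0 \<Longrightarrow> stone_cech_emb X x \<in> support f"
  unfolding support_def cozero_def
  by (rule subsetD[OF closure_of_subset]) (auto simp: stone_cech_emb_in)

lemma support_subset:
  assumes "closedin (stone_cech X) C" "\<And>x. x \<in> topspace X \<Longrightarrow> f x \<noteq> 0 \<Longrightarrow> stone_cech_emb X x \<in> C"
  shows "support f \<subseteq> C"
  unfolding support_def cozero_def by (rule closure_of_minimal) (use assms in auto)

end

text \<open>The inverse is carried along with symmetric assumptions, so that \<open>swap\<close>
  turns every result about \<open>T\<close> into one about \<open>S\<close>.\<close>

locale biseparating_pair = X: splitting_space X M + Y: splitting_space Y N
  for X :: "'a topology" and M :: "('a \<Rightarrow> 'e::real_normed_vector) set"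
    and Y :: "'b topology" and N :: "('b \<Rightarrow> 'f::real_normed_vector) set" +
  fixes T :: "('a \<Rightarrow> 'e) \<Rightarrow> ('b \<Rightarrow> 'f)" and S :: "('b \<Rightarrow> 'f) \<Rightarrow> ('a \<Rightarrow> 'e)"
  assumes T_in: "f \<in> M \<Longrightarrow> T f \<in> N" and S_in: "g \<in> N \<Longrightarrow> S g \<in> M"
    and ST: "f \<in> M \<Longrightarrow> S (T f) = f" and TS: "g \<in> N \<Longrightarrow> T (S g) = g"
    and T_add: "f \<in> M \<Longrightarrow> f' \<in> M \<Longrightarrow> T (\<lambda>x. f x + f' x) = (\<lambda>y. T f y + T f' y)"
    and S_add: "g \<in> N \<Longrightarrow> g' \<in> N \<Longrightarrow> S (\<lambda>y. g y + g' y) = (\<lambda>x. S g x + S g' x)"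
    and T_disjoint: "f \<in> M \<Longrightarrow> f' \<in> M \<Longrightarrow> \<forall>x\<in>topspace X. f x = 0 \<or> f' x = 0 \<Longrightarrow>
        y \<in> topspace Y \<Longrightarrow> T f y = 0 \<or> T f' y = 0"
    and S_disjoint: "g \<in> N \<Longrightarrow> g' \<in> N \<Longrightarrow> \<forall>y\<in>topspace Y. g y = 0 \<or> g' y = 0 \<Longrightarrow>
        x \<in> topspace X \<Longrightarrow> S g x = 0 \<or> S g' x = 0"
begin

lemma swap: "biseparating_pair Y N X M S T"
  by unfold_locales
    (fact T_in S_in ST TS T_add S_add T_disjoint S_disjoint)+

lemma T_zero: "T (\<lambda>x. 0) = (\<lambda>y. 0)"
proof -
  have "T (\<lambda>x. 0) y = T (\<lambda>x. 0) y + T (\<lambda>x. 0) y" for y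
    using fun_cong[OF T_add[OF X.zero X.zero], of y] by simp
  then show ?thesis by (intro ext) simp
qed

lemma T_diff:
  assumes "f \<in> M" "f' \<in> M"
  shows "T (\<lambda>x. f x - f' x) = (\<lambda>y. T f y - T f' y)"
  using T_add[OF X.diff[OF assms] assms(2)] by (auto simp: fun_eq_iff algebra_simps)

text \<open>As \<open>T\<close> is merely additive, natural multiples are the scalings used in both
  unboundedness arguments.\<close>

lemma T_of_nat:
  assumes "f \<in> M"
  shows "(\<lambda>x. of_nat n *\<^sub>R f x) \<in> M \<and> T (\<lambda>x. of_nat n *\<^sub>R f x) = (\<lambda>y. of_nat n *\<^sub>R T f y)"
proof (induction n)
  case 0
  then show ?case by (simp add: X.zero T_zero)
next
  case (Suc n)
  then show ?case
    using X.add[OF assms, of "\<lambda>x. of_nat n *\<^sub>R f x"] T_add[OF assms, of "\<lambda>x. of_nat n *\<^sub>R f x"]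
    by (simp add: algebra_simps)
qed

section \<open>Null sets and support points\<close>

definition null_set :: "'b \<Rightarrow> (('a \<Rightarrow> real) \<Rightarrow> real) set \<Rightarrow> bool" where
  "null_set y U \<longleftrightarrow> openin (stone_cech X) U \<and> (\<forall>f\<in>M. X.support f \<subseteq> U \<longrightarrow> T f y = 0)"

text \<open>A function supported in the union is cut into a piece supported in \<open>V\<close> and
  a piece supported in \<open>U\<close>, by means of a Urysohn function of \<beta>X that separates
  the parts of the support outside \<open>U\<close> and outside \<open>V\<close>.\<close>

lemma null_set_Un:
  assumes "null_set y U" "null_set y V"
  shows "null_set y (U \<union> V)"
  unfolding null_set_def
proof (intro conjI ballI impI)
  show "openin (stone_cech X) (U \<union> V)"
    using assms by (auto simp: null_set_def)
next
  fix f assume f: "f \<in> M" and sub: "X.support f \<subseteq> U \<union> V"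
  have "closedin (stone_cech X) (X.support f - U)" "closedin (stone_cech X) (X.support f - V)"
    using assms X.closedin_support by (auto simp: null_set_def intro: closedin_diff)
  moreover have "disjnt (X.support f - U) (X.support f - V)"
    using sub by (auto simp: disjnt_iff)
  ultimately obtain \<phi> where \<phi>: "continuous_map (stone_cech X) (top_of_set {0..1::real}) \<phi>"
      "\<phi> ` (X.support f - U) \<subseteq> {0}" "\<phi> ` (X.support f - V) \<subseteq> {1}"
    using Urysohn_lemma[OF normal_space_stone_cech, of X "X.support f - U" "X.support f - V" 0 1]
    by (metis zero_le_one)
  have c: "continuous_map (stone_cech X) euclideanreal \<phi>"
    using \<phi>(1) continuous_map_in_subtopology by blast
  have cl: "closedin (stone_cech X) {p \<in> topspace (stone_cech X). \<phi> p \<in> C}" if "closed C" for C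
    by (rule closedin_continuous_map_preimage[OF c]) (use that in simp)
  \<comment> \<open>On \<open>?K\<close> the cut-off \<open>g\<close> keeps \<open>f\<close>, on
    \<open>?L\<close> it is 0; in between its values are not controlled. The larger sets
    \<open>?K'\<close> and \<open>?L'\<close> then contain the supports of \<open>g\<close> and of
    \<open>f - g\<close>.\<close>
  let ?K = "{p \<in> topspace (stone_cech X). \<phi> p \<in> {..1/3}}"
  let ?L = "{p \<in> topspace (stone_cech X). \<phi> p \<in> {2/3..}}"
  let ?K' = "{p \<in> topspace (stone_cech X). \<phi> p \<in> {..2/3}}"
  let ?L' = "{p \<in> topspace (stone_cech X). \<phi> p \<in> {1/3..}}"
  have "disjnt ?K ?L" by (auto simp: disjnt_iff)
  then obtain g where gM: "g \<in> M"
    and "\<forall>x\<in>topspace X. (stone_cech_emb X x \<in> ?K \<longrightarrow> g x = f x) \<and>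
        (stone_cech_emb X x \<in> ?L \<longrightarrow> g x = 0) \<and> (f x = 0 \<longrightarrow> g x = 0)"
    using X.split[OF cl[OF closed_atMost] cl[OF closed_atLeast] _ f] by blast
  then have g: "\<And>x. x \<in> topspace X \<Longrightarrow> \<phi> (stone_cech_emb X x) \<le> 1/3 \<Longrightarrow> g x = f x"
      "\<And>x. x \<in> topspace X \<Longrightarrow> \<phi> (stone_cech_emb X x) \<ge> 2/3 \<Longrightarrow> g x = 0"
      "\<And>x. x \<in> topspace X \<Longrightarrow> f x = 0 \<Longrightarrow> g x = 0"
    by (simp_all add: stone_cech_emb_in)
  have "X.support g \<subseteq> X.support f \<inter> ?K'"
  proof (rule X.support_subset)
    show "closedin (stone_cech X) (X.support f \<inter> ?K')"
      by (intro closedin_Int X.closedin_support cl closed_atMost)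
    fix x assume x: "x \<in> topspace X" "g x \<noteq> 0"
    then have "\<not> \<phi> (stone_cech_emb X x) \<ge> 2/3" "f x \<noteq> 0" using g(2,3)[of x] by blast+
    then show "stone_cech_emb X x \<in> X.support f \<inter> ?K'"
      using x X.in_support by (auto simp: stone_cech_emb_in)
  qed
  then have "X.support g \<subseteq> V" using \<phi>(3) by fastforce
  then have 1: "T g y = 0" using assms(2) gM by (auto simp: null_set_def)
  have "X.support (\<lambda>x. f x - g x) \<subseteq> X.support f \<inter> ?L'"
  proof (rule X.support_subset)
    show "closedin (stone_cech X) (X.support f \<inter> ?L')"
      by (intro closedin_Int X.closedin_support cl closed_atLeast)
    fix x assume x: "x \<in> topspace X" "f x - g x \<noteq> 0"
    then have "\<not> \<phi> (stone_cech_emb X x) \<le> 1/3" "f x \<noteq> 0" using g(1,3)[of x] by auto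
    then show "stone_cech_emb X x \<in> X.support f \<inter> ?L'"
      using x X.in_support by (auto simp: stone_cech_emb_in)
  qed
  then have "X.support (\<lambda>x. f x - g x) \<subseteq> U" using \<phi>(2) by fastforce
  then have "T (\<lambda>x. f x - g x) y = 0"
    using assms(1) X.diff[OF f gM] by (auto simp: null_set_def)
  then show "T f y = 0"
    using 1 T_diff[OF f gM] by simp
qed

text \<open>Compactness of \<beta>X: otherwise null sets cover it, finitely many suffice, and their
  union \<beta>X is itself null. Then every \<open>T f\<close> vanishes at \<open>y\<close>,
  although \<open>T\<close> is onto and some member of \<open>N\<close> is nonzero there.\<close>

lemma ex_support_point:
  assumes y: "y \<in> topspace Y"
  shows "\<exists>p\<in>topspace (stone_cech X). \<forall>U. openin (stone_cech X) U \<and> p \<in> U \<longrightarrow>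
           (\<exists>f\<in>M. X.support f \<subseteq> U \<and> T f y \<noteq> 0)"
proof (rule ccontr)
  assume "\<not> ?thesis"
  then have "\<forall>p\<in>topspace (stone_cech X). \<exists>U. openin (stone_cech X) U \<and> p \<in> U \<and>
      (\<forall>f\<in>M. X.support f \<subseteq> U \<longrightarrow> T f y = 0)"
    by simp
  then have "\<forall>p\<in>topspace (stone_cech X). \<exists>U. null_set y U \<and> p \<in> U"
    unfolding null_set_def by meson
  then have "topspace (stone_cech X) \<subseteq> \<Union>{U. null_set y U}" by (simp add: subset_iff)
  moreover have "openin (stone_cech X) U" if "U \<in> {U. null_set y U}" for U
    using that by (simp add: null_set_def)
  ultimately obtain \<F> where \<F>: "finite \<F>" "\<F> \<subseteq> {U. null_set y U}" "topspace (stone_cech X) \<subseteq> \<Union>\<F>"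
    using compact_space_stone_cech[of X] unfolding compact_space_def compactin_def by meson
  have "null_set y (\<Union>\<F>)" using \<F>(1,2)
  proof (induction rule: finite_induct)
    case empty
    have "T f y = 0" if "f \<in> M" "X.support f \<subseteq> {}" for f
    proof -
      have "f = (\<lambda>x. 0)"
        using that X.in_support[of _ f] X.outside[of f] by blast
      then show ?thesis using T_zero by simp
    qed
    then show ?case by (auto simp: null_set_def)
  next
    case (insert U \<F>)
    then show ?case using null_set_Un by auto
  qed
  then have "T f y = 0" if "f \<in> M" for f
    using that \<F>(3) closedin_subset[OF X.closedin_support[of f]] by (auto simp: null_set_def)
  then show False
    using Y.nonvanishing[OF y] TS S_in by fastforce
qed

section \<open>The induced map of Stone-Cech compactifications\<close>

definition localises :: "((('b \<Rightarrow> real) \<Rightarrow> real) \<Rightarrow> (('a \<Rightarrow> real) \<Rightarrow> real)) \<Rightarrow> bool" where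
  "localises h \<longleftrightarrow> continuous_map (stone_cech Y) (stone_cech X) h \<and>
     (\<forall>y\<in>topspace Y. \<forall>U. openin (stone_cech X) U \<and> h (stone_cech_emb Y y) \<in> U \<longrightarrow>
        (\<forall>f\<in>M. (\<forall>x\<in>topspace X. stone_cech_emb X x \<in> U \<longrightarrow> f x = 0) \<longrightarrow> T f y = 0))"

text \<open>Each \<open>y\<close> is sent to a support point; the resulting map is continuous on Y
  and extends to \<beta>Y by the universal property.\<close>

lemma ex_localises: "\<exists>h. localises h"
proof -
  obtain P where P: "\<And>y. y \<in> topspace Y \<Longrightarrow> P y \<in> topspace (stone_cech X)"
      "\<And>y U. y \<in> topspace Y \<Longrightarrow> openin (stone_cech X) U \<Longrightarrow> P y \<in> U \<Longrightarrow>
        \<exists>f\<in>M. X.support f \<subseteq> U \<and> T f y \<noteq> 0"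
    using ex_support_point by metis
  \<comment> \<open>If \<open>f\<close> vanishes near the support point, it is disjoint from some
    \<open>f'\<close> supported there with \<open>T f' y \<noteq> 0\<close>; the separating property
    then forces \<open>T f y = 0\<close>.\<close>
  have vanish: "T f y = 0" if y: "y \<in> topspace Y" and U: "openin (stone_cech X) U" "P y \<in> U"
      and f: "f \<in> M" "\<And>x. x \<in> topspace X \<Longrightarrow> stone_cech_emb X x \<in> U \<Longrightarrow> f x = 0" for y U f
  proof -
    obtain f' where f': "f' \<in> M" "X.support f' \<subseteq> U" "T f' y \<noteq> 0"
      using P y U by metis
    then have "\<forall>x\<in>topspace X. f x = 0 \<or> f' x = 0"
      using f X.in_support[of _ f'] by blast
    then show ?thesis using T_disjoint[OF f(1) f'(1) _ y] f'(3) by blast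
  qed
  have "continuous_map Y (stone_cech X) P"
    unfolding continuous_map
  proof (intro conjI allI impI)
    show "P ` topspace Y \<subseteq> topspace (stone_cech X)" using P(1) by blast
    fix U assume U: "openin (stone_cech X) U"
    show "openin Y {y \<in> topspace Y. P y \<in> U}"
    proof (subst openin_subopen, intro ballI)
      fix y assume "y \<in> {y \<in> topspace Y. P y \<in> U}"
      then obtain f where f: "f \<in> M" "X.support f \<subseteq> U" "T f y \<noteq> 0" and y: "y \<in> topspace Y"
        using P(2)[of y U] U by auto
      \<comment> \<open>\<open>P\<close> maps this open set into \<open>U\<close>: at a point
        \<open>z\<close> with \<open>P z\<close> outside the support of \<open>f\<close>,
        \<open>vanish\<close> would give \<open>T f z = 0\<close>.\<close>
      let ?V = "{y \<in> topspace Y. T f y \<in> - {0}}"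
      have "P z \<in> U" if "z \<in> ?V" for z
      proof (rule ccontr)
        assume "P z \<notin> U"
        then have "P z \<in> topspace (stone_cech X) - X.support f" using f P(1) that by auto
        then have "T f z = 0"
          using vanish[OF _ _ _ f(1), of z "topspace (stone_cech X) - X.support f"] that
            X.closedin_support X.in_support by blast
        then show False using that by simp
      qed
      moreover have "openin Y ?V"
        by (rule openin_continuous_map_preimage[OF Y.cont[OF T_in[OF f(1)]]]) (simp add: open_Compl)
      ultimately show "\<exists>V. openin Y V \<and> y \<in> V \<and> V \<subseteq> {y \<in> topspace Y. P y \<in> U}"
        using y f(3) by (intro exI[of _ ?V]) auto
    qed
  qed
  then obtain h where h: "continuous_map (stone_cech Y) (stone_cech X) h"
      "\<forall>y\<in>topspace Y. h (stone_cech_emb Y y) = P y"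
    using stone_cech_extension[OF compact_space_stone_cech Hausdorff_space_stone_cech] by blast
  then have "localises h"
    unfolding localises_def using vanish by auto
  then show ?thesis by blast
qed

text \<open>By density only points \<open>x\<close> of X matter. If \<open>h (k x)\<close> differed
  from \<open>x\<close>, some \<open>f\<close> with \<open>f x \<noteq> 0\<close> would vanish near
  \<open>h (k x)\<close>; then \<open>T f\<close> vanishes near \<open>k x\<close>, and hence
  \<open>f = S (T f)\<close> vanishes at \<open>x\<close>.\<close>

lemma localises_inverse:
  assumes h: "localises h" and k: "biseparating_pair.localises Y N X S k"
    and p: "p \<in> topspace (stone_cech X)"
  shows "h (k p) = p"
proof -
  interpret swapped: biseparating_pair Y N X M S T by (rule swap)
  have ch: "continuous_map (stone_cech Y) (stone_cech X) h" using h by (simp add: localises_def)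
  have ck: "continuous_map (stone_cech X) (stone_cech Y) k" using k by (simp add: swapped.localises_def)
  have chk: "continuous_map (stone_cech X) (stone_cech X) (h \<circ> k)"
    using ch ck continuous_map_compose by blast
  have "(h \<circ> k) p = id p"
  proof (rule stone_cech_eqI[OF Hausdorff_space_stone_cech chk _ _ p])
    show "continuous_map (stone_cech X) (stone_cech X) id" by simp
    fix x assume x: "x \<in> topspace X"
    let ?e = "stone_cech_emb X x"
    show "(h \<circ> k) ?e = id ?e"
    proof (rule ccontr)
      assume "(h \<circ> k) ?e \<noteq> id ?e"
      moreover have "(h \<circ> k) ?e \<in> topspace (stone_cech X)" and e: "?e \<in> topspace (stone_cech X)"
        using chk x stone_cech_emb_in[of x X] by (auto simp: continuous_map_def)
      ultimately obtain U V where UV: "openin (stone_cech X) U" "openin (stone_cech X) V"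
          "h (k ?e) \<in> U" "?e \<in> V" "disjnt U V"
        using Hausdorff_space_stone_cech[of X] unfolding Hausdorff_space_def by (metis comp_apply id_apply)
      obtain f0 where f0: "f0 \<in> M" "f0 x \<noteq> 0" using X.nonvanishing[OF x] by blast
      have "closedin (stone_cech X) {?e}" "closedin (stone_cech X) (topspace (stone_cech X) - V)"
        using e UV Hausdorff_space_stone_cech[of X] by (auto simp: closedin_Hausdorff_singleton)
      moreover have "disjnt {?e} (topspace (stone_cech X) - V)" using UV by auto
      ultimately obtain f where f: "f \<in> M" "f x = f0 x"
          "\<And>z. z \<in> topspace X \<Longrightarrow> stone_cech_emb X z \<in> topspace (stone_cech X) - V \<Longrightarrow> f z = 0"
        using X.split[OF _ _ _ f0(1)] x by (metis (lifting) singletonI)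
      have f_U: "f z = 0" if "z \<in> topspace X" "stone_cech_emb X z \<in> U" for z
        using f(3)[of z] that UV stone_cech_emb_in[of z X] by (auto simp: disjnt_iff)
      have "S (T f) x = 0"
      proof -
        let ?V = "{q \<in> topspace (stone_cech Y). h q \<in> U}"
        have "openin (stone_cech Y) ?V" using openin_continuous_map_preimage[OF ch UV(1)] .
        moreover have "k ?e \<in> ?V" using UV(3) ck e by (auto simp: continuous_map_def)
        moreover have "T f y = 0" if "y \<in> topspace Y" "stone_cech_emb Y y \<in> ?V" for y
          using h f f_U UV(1) that unfolding localises_def by blast
        ultimately show ?thesis
          using k x T_in[OF f(1)] unfolding swapped.localises_def by blast
      qed
      then show False using ST[OF f(1)] f(2) f0(2) by simp
    qed
  qed
  then show ?thesis by simp
qed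

end


section \<open>Points of the realcompactification\<close>

text \<open>With value 0 at infinity this function turns infinite values of an extension into zeros
  of a continuous real function.\<close>

lemma continuous_map_Alexandroff_reciprocal:
  "continuous_map (Alexandroff_compactification euclideanreal) euclideanreal
     (case_option 0 (\<lambda>t. 1 / (1 + \<bar>t\<bar>)))" (is "continuous_map ?Z _ ?\<phi>")
  unfolding continuous_map
proof (intro conjI allI impI)
  fix U :: "real set" assume "openin euclideanreal U"
  then have U: "open U" by simp
  have c: "continuous_on UNIV (\<lambda>t::real. 1 / (1 + \<bar>t\<bar>))"
    by (intro continuous_intros) (simp add: add_nonneg_eq_0_iff)
  let ?W = "(\<lambda>t::real. 1 / (1 + \<bar>t\<bar>)) -` U"
  have W: "open ?W" using open_vimage[OF U c] .
  show "openin ?Z {z \<in> topspace ?Z. ?\<phi> z \<in> U}"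
  proof (cases "0 \<in> U")
    case True
    then obtain \<epsilon> where \<epsilon>: "\<epsilon> > 0" "ball 0 \<epsilon> \<subseteq> U" using U open_contains_ball by blast
    \<comment> \<open>A neighbourhood of 0 contains a ball, so it pulls back to the complement of a
      bounded closed set, that is, to a neighbourhood of infinity.\<close>
    have "- ?W \<subseteq> cball 0 (1 / \<epsilon>)"
    proof
      fix t assume "t \<in> - ?W"
      then have "1 / (1 + \<bar>t\<bar>) \<notin> ball 0 \<epsilon>" using \<epsilon>(2) by blast
      then have "\<epsilon> \<le> 1 / (1 + \<bar>t\<bar>)" by (simp add: add_pos_nonneg)
      then have "\<epsilon> * (1 + \<bar>t\<bar>) \<le> 1" by (simp add: pos_le_divide_eq add_pos_nonneg)
      then have "\<epsilon> * \<bar>t\<bar> \<le> 1" using \<epsilon>(1) by (simp add: algebra_simps)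
      then show "t \<in> cball 0 (1 / \<epsilon>)" using \<epsilon>(1) by (simp add: field_simps)
    qed
    then have "compact (- ?W)"
      using W by (metis bounded_cball bounded_subset closed_Compl compact_eq_bounded_closed)
    moreover have "z \<in> {z \<in> topspace ?Z. ?\<phi> z \<in> U} \<longleftrightarrow>
        z \<in> insert None (Some ` (topspace euclideanreal - - ?W))" for z
      using True by (cases z) auto
    then have "{z \<in> topspace ?Z. ?\<phi> z \<in> U} = insert None (Some ` (topspace euclideanreal - - ?W))"
      by (rule set_eqI)
    ultimately show ?thesis
      using W unfolding openin_Alexandroff_compactification
      by (intro disjI2 exI[of _ "- ?W"]) auto
  next
    case False
    then have "z \<in> {z \<in> topspace ?Z. ?\<phi> z \<in> U} \<longleftrightarrow> z \<in> Some ` ?W" for z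
      by (cases z) auto
    then have "{z \<in> topspace ?Z. ?\<phi> z \<in> U} = Some ` ?W"
      by (rule set_eqI)
    then show ?thesis
      using W unfolding openin_Alexandroff_compactification by auto
  qed
qed simp

lemma is_beta_extension_beta_extension:
  fixes f :: "'a \<Rightarrow> 'k::real_or_complex"
  assumes "continuous_map X euclidean f"
  shows "is_beta_extension X f (beta_extension X f)"
  unfolding beta_extension_def by (rule theI'[OF ex1_is_beta_extension[OF assms]])

lemma beta_extension_emb:
  fixes f :: "'a \<Rightarrow> 'k::real_or_complex"
  assumes "continuous_map X euclidean f" "x \<in> topspace X"
  shows "beta_extension X f (stone_cech_emb X x) = Some (f x)"
  using is_beta_extension_beta_extension[OF assms(1)] assms(2) by (simp add: is_beta_extension_def)

text \<open>The reciprocal of the extension of \<open>w\<close> and the function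
  \<open>\<Omega>\<close> agree on the dense image of X, hence on \<beta>X; the reciprocal is 0 only
  at infinity.\<close>

lemma beta_extension_eq_None_iff:
  fixes w :: "'a \<Rightarrow> real"
  assumes w: "continuous_map X euclideanreal w"
    and \<Omega>: "continuous_map (stone_cech X) euclideanreal \<Omega>"
      "\<And>x. x \<in> topspace X \<Longrightarrow> \<Omega> (stone_cech_emb X x) = 1 / (1 + \<bar>w x\<bar>)"
    and p: "p \<in> topspace (stone_cech X)"
  shows "beta_extension X w p = None \<longleftrightarrow> \<Omega> p = 0"
proof -
  have "continuous_map (stone_cech X) (Alexandroff_compactification euclidean) (beta_extension X w)"
    using is_beta_extension_beta_extension[OF w] by (simp add: is_beta_extension_def)
  then have c: "continuous_map (stone_cech X) euclideanreal
      (case_option 0 (\<lambda>t. 1 / (1 + \<bar>t\<bar>)) \<circ> beta_extension X w)"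
    using continuous_map_compose continuous_map_Alexandroff_reciprocal by blast
  have "(case_option 0 (\<lambda>t. 1 / (1 + \<bar>t\<bar>)) \<circ> beta_extension X w) p = \<Omega> p"
    by (rule stone_cech_eqI[OF _ c \<Omega>(1) _ p]) (simp_all add: beta_extension_emb[OF w] \<Omega>(2))
  then show ?thesis
    by (cases "beta_extension X w p") (auto simp: add_nonneg_eq_0_iff)
qed

text \<open>The functions correspond by \<open>\<Omega> = 1 / (1 + \<bar>w\<bar>)\<close> and
  \<open>w = 1 / \<Omega> - 1\<close>. The criterion speaks of real functions on \<beta>X, which can
  be transported along \<open>h\<close>.\<close>

lemma in_realcompactification_iff:
  "p \<in> topspace (realcompactification X) \<longleftrightarrow> p \<in> topspace (stone_cech X) \<and>
     (\<forall>\<Omega>. continuous_map (stone_cech X) euclideanreal \<Omega> \<and>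
        (\<forall>x\<in>topspace X. 0 < \<Omega> (stone_cech_emb X x) \<and> \<Omega> (stone_cech_emb X x) \<le> 1) \<longrightarrow> \<Omega> p \<noteq> 0)"
    (is "_ \<longleftrightarrow> _ \<and> ?R")
proof -
  have 1: "beta_extension X w p \<noteq> None"
    if p: "p \<in> topspace (stone_cech X)" and R: ?R and "w \<in> cont_funs X" for w :: "'a \<Rightarrow> real"
  proof -
    have w: "continuous_map X euclideanreal w" using that by (simp add: cont_funs_def)
    have pos: "0 < 1 + \<bar>w x\<bar>" for x by (simp add: add_pos_nonneg)
    then have nz: "1 + \<bar>w x\<bar> \<noteq> 0" for x by (metis less_irrefl)
    have "continuous_map X euclideanreal (\<lambda>x. 1 / (1 + \<bar>w x\<bar>))"
      by (intro continuous_intros w) (use nz in auto)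
    then have "continuous_map X (top_of_set {0..1}) (\<lambda>x. 1 / (1 + \<bar>w x\<bar>))"
      by (auto simp: continuous_map_in_subtopology divide_simps add_pos_nonneg)
    from stone_cech_extension[OF _ _ this]
    obtain \<Omega> where \<Omega>: "continuous_map (stone_cech X) (top_of_set {0..1}) \<Omega>"
        "\<forall>x\<in>topspace X. \<Omega> (stone_cech_emb X x) = 1 / (1 + \<bar>w x\<bar>)"
      by (auto simp: compact_space_subtopology Hausdorff_space_subtopology)
    then have c: "continuous_map (stone_cech X) euclideanreal \<Omega>"
      using continuous_map_in_subtopology by blast
    have "\<forall>x\<in>topspace X. 0 < \<Omega> (stone_cech_emb X x) \<and> \<Omega> (stone_cech_emb X x) \<le> 1"
      using \<Omega>(2) pos by simp
    then have "\<Omega> p \<noteq> 0"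
      using R c by blast
    then show ?thesis
      using beta_extension_eq_None_iff[OF w c _ p] \<Omega>(2) by simp
  qed
  have 2: "\<exists>w::'a \<Rightarrow> real. w \<in> cont_funs X \<and> beta_extension X w p = None"
    if p: "p \<in> topspace (stone_cech X)" and \<Omega>: "continuous_map (stone_cech X) euclideanreal \<Omega>"
      "\<forall>x\<in>topspace X. 0 < \<Omega> (stone_cech_emb X x) \<and> \<Omega> (stone_cech_emb X x) \<le> 1" "\<Omega> p = 0" for \<Omega>
  proof -
    define w where "w x = (if x \<in> topspace X then 1 / \<Omega> (stone_cech_emb X x) - 1 else 0)" for x
    have "continuous_map X euclideanreal (\<Omega> \<circ> stone_cech_emb X)"
      using continuous_map_compose[OF continuous_stone_cech_emb \<Omega>(1)] .
    then have "continuous_map X euclideanreal (\<lambda>x. 1 / \<Omega> (stone_cech_emb X x) - 1)"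
      using \<Omega>(2) by (intro continuous_intros) (auto simp: o_def)
    then have w: "continuous_map X euclideanreal w"
      by (rule continuous_map_eq) (simp add: w_def)
    have "\<Omega> (stone_cech_emb X x) = 1 / (1 + \<bar>w x\<bar>)" if "x \<in> topspace X" for x
      using \<Omega>(2) that by (simp add: w_def)
    then have "beta_extension X w p = None"
      using beta_extension_eq_None_iff[OF w \<Omega>(1) _ p] \<Omega>(3) by simp
    then show ?thesis using w by (auto simp: cont_funs_def w_def)
  qed
  have "p \<in> topspace (realcompactification X) \<longleftrightarrow> p \<in> topspace (stone_cech X) \<and>
      (\<forall>w \<in> (cont_funs X :: ('a \<Rightarrow> real) set). beta_extension X w p \<noteq> None)"
    unfolding realcompactification_def by auto
  also have "\<dots> \<longleftrightarrow> p \<in> topspace (stone_cech X) \<and> ?R"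
    using 1 2 by meson
  finally show ?thesis .
qed

section \<open>Companion functions\<close>

context biseparating_pair
begin

text \<open>This is all that is needed of the pair \<open>\<Omega>\<close> on \<open>X\<close> and \<open>\<Omega> \<circ> h\<close> on \<open>Y\<close>, so that \<open>\<beta>X\<close> and \<open>h\<close>
  can be forgotten.\<close>

definition companion :: "('a \<Rightarrow> real) \<Rightarrow> ('b \<Rightarrow> real) \<Rightarrow> bool" where
  "companion \<omega> \<sigma> \<longleftrightarrow>
     continuous_map X euclideanreal \<omega> \<and> continuous_map Y euclideanreal \<sigma> \<and>
     (\<forall>x\<in>topspace X. 0 < \<omega> x \<and> \<omega> x \<le> 1) \<and> (\<forall>y\<in>topspace Y. 0 \<le> \<sigma> y \<and> \<sigma> y \<le> 1) \<and>
     (\<forall>V y. openin Y V \<and> y \<in> V \<longrightarrow> (\<exists>z\<in>V. 0 < \<sigma> z)) \<and>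
     (\<forall>J. open J \<longrightarrow>
        (\<forall>f\<in>M. \<forall>f'\<in>M. (\<forall>x\<in>topspace X. \<omega> x \<in> J \<longrightarrow> f x = f' x) \<longrightarrow>
           (\<forall>y\<in>topspace Y. \<sigma> y \<in> J \<longrightarrow> T f y = T f' y)) \<and>
        (\<forall>g\<in>N. \<forall>g'\<in>N. (\<forall>y\<in>topspace Y. \<sigma> y \<in> J \<longrightarrow> g y = g' y) \<longrightarrow>
           (\<forall>x\<in>topspace X. \<omega> x \<in> J \<longrightarrow> S g x = S g' x)))"

lemma localises_eq:
  assumes h: "localises h" and \<Omega>: "continuous_map (stone_cech X) euclideanreal \<Omega>" and "open J"
    and f: "f \<in> M" "f' \<in> M" "\<And>x. x \<in> topspace X \<Longrightarrow> \<Omega> (stone_cech_emb X x) \<in> J \<Longrightarrow> f x = f' x"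
    and y: "y \<in> topspace Y" "\<Omega> (h (stone_cech_emb Y y)) \<in> J"
  shows "T f y = T f' y"
proof -
  let ?U = "{p \<in> topspace (stone_cech X). \<Omega> p \<in> J}"
  have "openin (stone_cech X) ?U"
    using openin_continuous_map_preimage[OF \<Omega>] \<open>open J\<close> by simp
  moreover have "h (stone_cech_emb Y y) \<in> ?U"
    using h y stone_cech_emb_in[of y Y] by (auto simp: localises_def continuous_map_def)
  ultimately have "T (\<lambda>x. f x - f' x) y = 0"
    using h y X.diff[OF f(1,2)] f(3) unfolding localises_def by fastforce
  then show ?thesis using T_diff[OF f(1,2)] by simp
qed

text \<open>A priori \<open>h\<close> need not send Y into X, so positivity of
  \<open>\<Omega>\<close> on X yields only nonnegativity of \<open>\<Omega> \<circ> h\<close> on Y,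
  with positive values on a dense set.\<close>

lemma companion_localises:
  assumes h: "localises h" and k: "biseparating_pair.localises Y N X S k"
    and \<Omega>: "continuous_map (stone_cech X) euclideanreal \<Omega>"
      "\<And>x. x \<in> topspace X \<Longrightarrow> 0 < \<Omega> (stone_cech_emb X x) \<and> \<Omega> (stone_cech_emb X x) \<le> 1"
  shows "companion (\<lambda>x. \<Omega> (stone_cech_emb X x)) (\<lambda>y. \<Omega> (h (stone_cech_emb Y y)))"
proof -
  interpret swapped: biseparating_pair Y N X M S T by (rule swap)
  have ch: "continuous_map (stone_cech Y) (stone_cech X) h" using h by (simp add: localises_def)
  have ck: "continuous_map (stone_cech X) (stone_cech Y) k" using k by (simp add: swapped.localises_def)
  have kh: "k (h q) = q" if "q \<in> topspace (stone_cech Y)" for q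
    using swapped.localises_inverse[OF k h that] .
  have hk: "h (k p) = p" if "p \<in> topspace (stone_cech X)" for p
    using localises_inverse[OF h k that] .
  have \<Omega>h: "continuous_map (stone_cech Y) euclideanreal (\<Omega> \<circ> h)"
    using continuous_map_compose[OF ch \<Omega>(1)] .
  have 1: "continuous_map X euclideanreal (\<Omega> \<circ> stone_cech_emb X)"
    using continuous_map_compose[OF continuous_stone_cech_emb \<Omega>(1)] .
  have 2: "continuous_map Y euclideanreal ((\<Omega> \<circ> h) \<circ> stone_cech_emb Y)"
    using continuous_map_compose[OF continuous_stone_cech_emb \<Omega>h] .
  have "0 \<le> \<Omega> p \<and> \<Omega> p \<le> 1" if p: "p \<in> topspace (stone_cech X)" for p
  proof -
    have "closedin (stone_cech X) {p \<in> topspace (stone_cech X). \<Omega> p \<in> {0..1}}"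
      by (rule closedin_continuous_map_preimage[OF \<Omega>(1)]) simp
    then have "stone_cech X closure_of (stone_cech_emb X ` topspace X) \<subseteq>
        {p \<in> topspace (stone_cech X). \<Omega> p \<in> {0..1}}"
      by (rule closure_of_minimal[rotated])
         (use \<Omega>(2) stone_cech_emb_in[of _ X] in \<open>auto simp: less_imp_le\<close>)
    then show ?thesis using p by (auto simp: stone_cech_dense)
  qed
  then have 3: "0 \<le> \<Omega> (h (stone_cech_emb Y y)) \<and> \<Omega> (h (stone_cech_emb Y y)) \<le> 1"
    if "y \<in> topspace Y" for y
    using ch stone_cech_emb_in[OF that] by (auto simp: continuous_map_def)
  \<comment> \<open>The homeomorphism \<open>h\<close> carries a nonempty open subset of \<beta>Y to
    an open subset of \<beta>X, which contains a point of X; there \<open>\<Omega>\<close> is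
    positive. Positivity persists on an open subset of \<beta>Y, and this one meets Y.\<close>
  have 4: "\<exists>z\<in>V. 0 < \<Omega> (h (stone_cech_emb Y z))" if V: "openin Y V" "y \<in> V" for V y
  proof -
    obtain U where U: "openin (stone_cech Y) U" "stone_cech_emb Y y \<in> U"
        "\<And>z. z \<in> topspace Y \<Longrightarrow> stone_cech_emb Y z \<in> U \<Longrightarrow> z \<in> V"
      using stone_cech_neighbourhood[OF Y.completely_regular V] by metis
    let ?U = "{p \<in> topspace (stone_cech X). k p \<in> U}"
    have "openin (stone_cech X) ?U" using openin_continuous_map_preimage[OF ck U(1)] .
    moreover have "h (stone_cech_emb Y y) \<in> ?U"
      using U kh ch openin_subset by (fastforce simp: continuous_map_def)
    ultimately obtain x where x: "x \<in> topspace X" "stone_cech_emb X x \<in> ?U"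
      by (rule stone_cech_emb_meets_open)
    let ?V = "{q \<in> topspace (stone_cech Y). (\<Omega> \<circ> h) q \<in> {0<..}} \<inter> U"
    have "openin (stone_cech Y) ?V"
      by (intro openin_Int U(1) openin_continuous_map_preimage[OF \<Omega>h]) simp
    moreover have "k (stone_cech_emb X x) \<in> ?V"
      using x \<Omega>(2)[OF x(1)] hk openin_subset[OF U(1)] by auto
    ultimately obtain z where "z \<in> topspace Y" "stone_cech_emb Y z \<in> ?V"
      by (rule stone_cech_emb_meets_open)
    then show ?thesis using U(3) by auto
  qed
  \<comment> \<open>Locality of \<open>S\<close> is expressed through \<open>k\<close>, and
    \<open>h (k p) = p\<close> turns \<open>\<Omega> \<circ> h \<circ> k\<close> back into
    \<open>\<Omega>\<close>.\<close>
  have 5: "S g x = S g' x" if "open J" "g \<in> N" "g' \<in> N"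
    "\<forall>y\<in>topspace Y. \<Omega> (h (stone_cech_emb Y y)) \<in> J \<longrightarrow> g y = g' y"
    "x \<in> topspace X" "\<Omega> (stone_cech_emb X x) \<in> J" for J g g' x
    by (rule swapped.localises_eq[OF k \<Omega>h that(1-3)])
      (use that(4-6) hk stone_cech_emb_in[OF that(5)] in simp_all)
  have 6: "T f y = T f' y" if "open J" "f \<in> M" "f' \<in> M"
    "\<forall>x\<in>topspace X. \<Omega> (stone_cech_emb X x) \<in> J \<longrightarrow> f x = f' x"
    "y \<in> topspace Y" "\<Omega> (h (stone_cech_emb Y y)) \<in> J" for J f f' y
    by (rule localises_eq[OF h \<Omega>(1) that(1-3)]) (use that(4-6) in simp_all)
  show ?thesis
    unfolding companion_def
  proof (intro conjI allI impI ballI)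
    show "continuous_map X euclideanreal (\<lambda>x. \<Omega> (stone_cech_emb X x))"
      using 1 by (simp add: o_def)
    show "continuous_map Y euclideanreal (\<lambda>y. \<Omega> (h (stone_cech_emb Y y)))"
      using 2 by (simp add: o_def)
    show "0 < \<Omega> (stone_cech_emb X x)" "\<Omega> (stone_cech_emb X x) \<le> 1" if "x \<in> topspace X" for x
      using \<Omega>(2)[OF that] by simp_all
    show "0 \<le> \<Omega> (h (stone_cech_emb Y y))" "\<Omega> (h (stone_cech_emb Y y)) \<le> 1"
      if "y \<in> topspace Y" for y
      using 3[OF that] by simp_all
    show "\<exists>z\<in>V. 0 < \<Omega> (h (stone_cech_emb Y z))" if "openin Y V \<and> y \<in> V" for V y
      using that 4 by blast
    show "T f y = T f' y" if "open J" "f \<in> M" "f' \<in> M"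
      "\<forall>x\<in>topspace X. \<Omega> (stone_cech_emb X x) \<in> J \<longrightarrow> f x = f' x"
      "y \<in> topspace Y" "\<Omega> (h (stone_cech_emb Y y)) \<in> J" for J f f' y
      using that by (rule 6)
    show "S g x = S g' x" if "open J" "g \<in> N" "g' \<in> N"
      "\<forall>y\<in>topspace Y. \<Omega> (h (stone_cech_emb Y y)) \<in> J \<longrightarrow> g y = g' y"
      "x \<in> topspace X" "\<Omega> (stone_cech_emb X x) \<in> J" for J g g' x
      using that by (rule 5)
  qed
qed

text \<open>A test function \<open>\<Omega>\<close> on \<beta>X becomes the test function
  \<open>\<Omega> \<circ> h\<close> on \<beta>Y; \<open>pos\<close> supplies the strict positivity
  on Y that the criterion demands.\<close>

lemma localises_realcompactification:
  assumes h: "localises h" and k: "biseparating_pair.localises Y N X S k"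
    and pos: "\<And>\<omega> \<sigma> y. companion \<omega> \<sigma> \<Longrightarrow> y \<in> topspace Y \<Longrightarrow> \<sigma> y \<noteq> 0"
    and q: "q \<in> topspace (realcompactification Y)"
  shows "h q \<in> topspace (realcompactification X)"
  unfolding in_realcompactification_iff
proof (intro conjI allI impI)
  have ch: "continuous_map (stone_cech Y) (stone_cech X) h" using h by (simp add: localises_def)
  have q': "q \<in> topspace (stone_cech Y)" using q by (simp add: in_realcompactification_iff)
  show "h q \<in> topspace (stone_cech X)" using ch q' by (auto simp: continuous_map_def)
  fix \<Omega> assume \<Omega>: "continuous_map (stone_cech X) euclideanreal \<Omega> \<and>
      (\<forall>x\<in>topspace X. 0 < \<Omega> (stone_cech_emb X x) \<and> \<Omega> (stone_cech_emb X x) \<le> 1)"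
  let ?\<sigma> = "\<lambda>y. \<Omega> (h (stone_cech_emb Y y))"
  have c: "companion (\<lambda>x. \<Omega> (stone_cech_emb X x)) ?\<sigma>"
    using companion_localises[OF h k] \<Omega> by blast
  then have "\<forall>y\<in>topspace Y. 0 \<le> ?\<sigma> y \<and> ?\<sigma> y \<le> 1" by (simp add: companion_def)
  then have "\<forall>y\<in>topspace Y. 0 < ?\<sigma> y \<and> ?\<sigma> y \<le> 1"
    using pos[OF c] by (simp add: less_le)
  moreover have "continuous_map (stone_cech Y) euclideanreal (\<Omega> \<circ> h)"
    using continuous_map_compose[OF ch] \<Omega> by blast
  ultimately show "\<Omega> (h q) \<noteq> 0"
    using q unfolding in_realcompactification_iff by (metis comp_apply)
qed

text \<open>The maps \<open>h\<close> and \<open>k\<close> are mutually inverse homeomorphisms of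
  the compactifications, and each sends one realcompactification into the other, so they
  restrict.\<close>

theorem realcompactification_homeomorphic:
  assumes "\<And>\<omega> \<sigma> y. companion \<omega> \<sigma> \<Longrightarrow> y \<in> topspace Y \<Longrightarrow> \<sigma> y \<noteq> 0"
    and "\<And>\<omega> \<sigma> x. biseparating_pair.companion Y N X M S T \<omega> \<sigma> \<Longrightarrow> x \<in> topspace X \<Longrightarrow> \<sigma> x \<noteq> 0"
  shows "realcompactification X homeomorphic_space realcompactification Y"
proof -
  interpret swapped: biseparating_pair Y N X M S T by (rule swap)
  obtain h k where h: "localises h" and k: "swapped.localises k"
    using ex_localises swapped.ex_localises by blast
  have kh: "k (h q) = q" if "q \<in> topspace (stone_cech Y)" for q
    using swapped.localises_inverse[OF k h that] .
  have hk: "h (k p) = p" if "p \<in> topspace (stone_cech X)" for p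
    using localises_inverse[OF h k that] .
  have hm: "homeomorphic_maps (stone_cech X) (stone_cech Y) k h"
    unfolding homeomorphic_maps_def using h k kh hk
    by (simp add: localises_def swapped.localises_def)
  define U where "U = topspace (realcompactification X)"
  define V where "V = topspace (realcompactification Y)"
  have UV: "U \<subseteq> topspace (stone_cech X)" "V \<subseteq> topspace (stone_cech Y)"
    unfolding U_def V_def in_realcompactification_iff[abs_def] subset_iff by blast+
  have 1: "k p \<in> V" if "p \<in> U" for p
    using that unfolding U_def V_def
    by (rule swapped.localises_realcompactification[OF k h, rotated]) (fact assms(2))
  have 2: "h q \<in> U" if "q \<in> V" for q
    using that unfolding U_def V_def
    by (rule localises_realcompactification[OF h k, rotated]) (fact assms(1))
  have "q \<in> k ` U" if "q \<in> V" for q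
    using that 2[OF that] kh[of q] UV(2) by (auto intro!: image_eqI[of _ _ "h q"])
  then have "k ` (topspace (stone_cech X) \<inter> U) = topspace (stone_cech Y) \<inter> V"
    using UV 1 by (auto simp: Int_absorb1)
  then have "homeomorphic_maps (subtopology (stone_cech X) U) (subtopology (stone_cech Y) V) k h"
    by (rule homeomorphic_maps_subtopologies[OF hm])
  moreover have "realcompactification Z = subtopology (stone_cech Z) (topspace (realcompactification Z))"
    for Z :: "'z topology"
    unfolding realcompactification_def by (simp add: subtopology_restrict)
  ultimately show ?thesis
    unfolding U_def V_def homeomorphic_space_def by metis
qed

end


section \<open>Separated sequences in infinite-dimensional normed spaces\<close>

text \<open>Induction on the generators: for \<open>a\<close> outside the closed span of the others,
  the coefficient of \<open>a\<close> is controlled by the norm, so Cauchy sequences have Cauchy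
  coefficients.\<close>

lemma complete_span_finite:
  fixes S :: "'a::real_normed_vector set"
  assumes "finite S"
  shows "complete (span S)"
  using assms
proof (induction rule: finite_induct)
  case empty
  then show ?case by (simp add: compact_imp_complete)
next
  case (insert a S)
  show ?case
  proof (cases "a \<in> span S")
    case True
    then show ?thesis using insert.IH by (simp add: span_redundant)
  next
    case False
    have "closed (span S)" using insert.IH by (rule complete_imp_closed)
    moreover have "span S \<noteq> {}" using span_zero by blast
    ultimately have d: "infdist a (span S) > 0" using False infdist_pos_not_in_closed by blast
    define d where "d = infdist a (span S)"
    \<comment> \<open>The coefficient functional of \<open>a\<close> has norm at most
      \<open>1 / d\<close>: dividing by \<open>t\<close> reduces this to the distance of
      \<open>a\<close> from the span.\<close>
    have bound: "\<bar>t\<bar> * d \<le> norm (u + t *\<^sub>R a)" if "u \<in> span S" for t u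
    proof (cases "t = 0")
      case False
      have "d \<le> dist a ((- 1 / t) *\<^sub>R u)"
        unfolding d_def by (intro infdist_le span_scale that)
      also have "a - (- 1 / t) *\<^sub>R u = (1 / t) *\<^sub>R (u + t *\<^sub>R a)"
        using False by (simp add: algebra_simps)
      then have "dist a ((- 1 / t) *\<^sub>R u) = norm (u + t *\<^sub>R a) / \<bar>t\<bar>"
        by (simp add: dist_norm)
      finally show ?thesis using False by (simp add: field_simps)
    qed simp
    show ?thesis
      unfolding complete_def
    proof (intro allI impI, elim conjE)
      fix s :: "nat \<Rightarrow> 'a" assume s: "\<forall>n. s n \<in> span (insert a S)" "Cauchy s"
      then have "\<forall>n. \<exists>t. s n - t *\<^sub>R a \<in> span S" by (simp add: span_breakdown_eq)
      then obtain t where t: "\<And>n. s n - t n *\<^sub>R a \<in> span S" by metis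
      have diff: "\<bar>t m - t n\<bar> * d \<le> dist (s m) (s n)" for m n
        using bound[OF span_diff[OF t[of m] t[of n]], of "t m - t n"]
        by (simp add: dist_norm algebra_simps)
      have "Cauchy t"
      proof (rule metric_CauchyI)
        fix e :: real assume "e > 0"
        then have "e * d > 0" using d by (simp add: d_def)
        then obtain M where M: "\<And>m n. m \<ge> M \<Longrightarrow> n \<ge> M \<Longrightarrow> dist (s m) (s n) < e * d"
          using s(2) unfolding Cauchy_def by meson
        have "dist (t m) (t n) < e" if "m \<ge> M" "n \<ge> M" for m n
        proof -
          have "\<bar>t m - t n\<bar> * d < e * d" using diff[of m n] M[OF that] by linarith
          then show ?thesis using d by (simp add: d_def dist_real_def)
        qed
        then show "\<exists>M. \<forall>m\<ge>M. \<forall>n\<ge>M. dist (t m) (t n) < e" by blast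
      qed
      then obtain t' where t': "t \<longlonglongrightarrow> t'" using Cauchy_convergent convergent_def by blast
      then have ta: "(\<lambda>n. t n *\<^sub>R a) \<longlonglongrightarrow> t' *\<^sub>R a" by (intro tendsto_intros)
      have "Cauchy (\<lambda>n. s n - t n *\<^sub>R a)"
      proof (rule metric_CauchyI)
        fix e :: real assume "e > 0"
        then have e: "e / 2 > 0" by simp
        obtain M where M: "\<And>m n. m \<ge> M \<Longrightarrow> n \<ge> M \<Longrightarrow> dist (s m) (s n) < e / 2"
          using s(2) e unfolding Cauchy_def by meson
        obtain L where L: "\<And>m n. m \<ge> L \<Longrightarrow> n \<ge> L \<Longrightarrow> dist (t m *\<^sub>R a) (t n *\<^sub>R a) < e / 2"
          using LIMSEQ_imp_Cauchy[OF ta] e unfolding Cauchy_def by meson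
        have "dist (s m - t m *\<^sub>R a) (s n - t n *\<^sub>R a) < e" if "m \<ge> max M L" "n \<ge> max M L" for m n
          using M[of m n] L[of m n] that norm_diff_triangle_ineq[of "s m" "t n *\<^sub>R a" "s n" "t m *\<^sub>R a"]
          by (simp add: dist_norm norm_minus_commute algebra_simps)
        then show "\<exists>M. \<forall>m\<ge>M. \<forall>n\<ge>M. dist (s m - t m *\<^sub>R a) (s n - t n *\<^sub>R a) < e" by blast
      qed
      then obtain u where u: "u \<in> span S" "(\<lambda>n. s n - t n *\<^sub>R a) \<longlonglongrightarrow> u"
        by (rule completeE[OF insert.IH, rotated]) (simp_all add: t)
      have "s \<longlonglongrightarrow> u + t' *\<^sub>R a" using tendsto_add[OF u(2) ta] by simp
      moreover have "u + t' *\<^sub>R a \<in> span (insert a S)"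
        using u(1) unfolding span_breakdown_eq by (intro exI[of _ t']) simp
      ultimately show "\<exists>l\<in>span (insert a S). s \<longlonglongrightarrow> l" by blast
    qed
  qed
qed

text \<open>Riesz's lemma with constant 1/2: choose \<open>s\<close> in the span within twice the
  distance of \<open>a\<close> from it, and normalise \<open>a - s\<close>.\<close>

lemma Riesz_separated_vector:
  fixes S :: "'a::real_normed_vector set"
  assumes "finite S" "span S \<noteq> UNIV"
  shows "\<exists>v. norm v \<le> 1 \<and> (\<forall>s\<in>span S. 1 / 2 \<le> norm (v - s))"
proof -
  obtain a where a: "a \<notin> span S" using assms(2) by blast
  have ne: "span S \<noteq> {}" using span_zero by blast
  have "closed (span S)" using complete_span_finite[OF assms(1)] by (rule complete_imp_closed)
  then have d: "infdist a (span S) > 0" using a ne infdist_pos_not_in_closed by blast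
  have "\<exists>s\<in>span S. dist a s < 2 * infdist a (span S)"
  proof (rule ccontr)
    assume "\<not> ?thesis"
    then have "2 * infdist a (span S) \<le> infdist a (span S)"
      unfolding infdist_notempty[OF ne] by (intro cINF_greatest ne) (auto simp: infdist_notempty[OF ne] not_less)
    then show False using d by simp
  qed
  then obtain s where s: "s \<in> span S" "norm (a - s) < 2 * infdist a (span S)"
    by (auto simp: dist_norm)
  define r where "r = norm (a - s)"
  have r: "r > 0" using a s(1) by (auto simp: r_def)
  have "1 / 2 \<le> norm ((1 / r) *\<^sub>R (a - s) - u)" if u: "u \<in> span S" for u
  proof -
    have "infdist a (span S) \<le> dist a (s + r *\<^sub>R u)"
      by (intro infdist_le span_add span_scale s u)
    also have "(1 / r) *\<^sub>R (a - s) - u = (1 / r) *\<^sub>R (a - (s + r *\<^sub>R u))"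
      using r by (simp add: algebra_simps)
    then have "dist a (s + r *\<^sub>R u) = r * norm ((1 / r) *\<^sub>R (a - s) - u)"
      using r by (simp add: dist_norm)
    finally have "r < 2 * (r * norm ((1 / r) *\<^sub>R (a - s) - u))"
      using s(2) by (simp add: r_def)
    then show ?thesis using r by simp
  qed
  moreover have "norm ((1 / r) *\<^sub>R (a - s)) \<le> 1" using r by (simp add: r_def)
  ultimately show ?thesis by blast
qed

lemma ex_separated_sequence:
  assumes "\<And>S :: 'a::real_normed_vector set. finite S \<Longrightarrow> span S \<noteq> UNIV"
  shows "\<exists>v :: nat \<Rightarrow> 'a. (\<forall>n. norm (v n) \<le> 1) \<and> (\<forall>m n. m \<noteq> n \<longrightarrow> 1 / 2 \<le> norm (v m - v n))"
proof -
  have "\<exists>v :: nat \<Rightarrow> 'a. \<forall>n. norm (v n) \<le> 1 \<and> (\<forall>m<n. 1 / 2 \<le> norm (v n - v m))"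
  proof (rule dependent_wellorder_choice)
    fix n and v :: "nat \<Rightarrow> 'a"
    obtain w where "norm w \<le> 1" "\<forall>s\<in>span (v ` {..<n}). 1 / 2 \<le> norm (w - s)"
      using Riesz_separated_vector[of "v ` {..<n}"] assms by auto
    then show "\<exists>w. norm w \<le> 1 \<and> (\<forall>m<n. 1 / 2 \<le> norm (w - v m))"
      by (intro exI[of _ w]) (auto intro: span_base)
  qed simp
  then obtain v :: "nat \<Rightarrow> 'a" where v: "\<And>n. norm (v n) \<le> 1" "\<And>m n. m < n \<Longrightarrow> 1 / 2 \<le> norm (v n - v m)"
    by blast
  have "1 / 2 \<le> norm (v m - v n)" if "m \<noteq> n" for m n
    using that v(2)[of m n] v(2)[of n m] by (cases m n rule: linorder_cases) (auto simp: norm_minus_commute)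
  then show ?thesis using v(1) by blast
qed

text \<open>Infinite dimension refers to the given scalars, whereas the separated sequence is built
  with real spans. A finite real spanning set also spans over the scalars and contains a
  basis.\<close>

lemma finite_dimensional_if_real_span:
  fixes smul :: "'k::real_or_complex \<Rightarrow> 'e::real_normed_vector \<Rightarrow> 'e" and S :: "'e set"
  assumes "normed_space_over smul" "finite S" "span S = UNIV"
  shows "\<not> infinite_dimensional smul"
proof -
  interpret V: normed_space_over smul by fact
  have "subspace (V.span S)"
    unfolding subspace_def
    using V.span_zero V.span_add V.span_scale V.scale_of_real by metis
  then have "span S \<subseteq> V.span S"
    using V.span_superset by (intro span_minimal)
  then have UN: "V.span S = UNIV" using assms(3) by blast
  obtain B where B: "B \<subseteq> S" "V.independent B" "S \<subseteq> V.span B"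
    using V.maximal_independent_subset[of S] by blast
  have "V.span B = UNIV"
    using UN B(3) V.span_minimal[OF B(3) V.subspace_span] by blast
  then have "finite_dimensional_vector_space smul B"
    using B assms(2) by unfold_locales (auto intro: finite_subset)
  then show ?thesis unfolding infinite_dimensional_def by blast
qed

section \<open>Sums of functions with disjoint cozero sets\<close>

text \<open>Where infinitely many terms are nonzero the value is 0 by convention; in every use at
  most one term is nonzero at each point.\<close>

definition disjoint_sum :: "(nat \<Rightarrow> 'a \<Rightarrow> 'e::real_normed_vector) \<Rightarrow> 'a \<Rightarrow> 'e" where
  "disjoint_sum F x = (\<Sum>n | F n x \<noteq> 0. F n x)"

lemma disjoint_sum_eq:
  assumes "\<And>m. m \<noteq> n \<Longrightarrow> F m x = 0"
  shows "disjoint_sum F x = F n x"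
proof (cases "F n x = 0")
  case True
  then have "F m x = 0" for m using assms by (cases "m = n") auto
  then show ?thesis by (simp add: disjoint_sum_def)
next
  case False
  then have "{n. F n x \<noteq> 0} = {n}" using assms by blast
  then show ?thesis by (simp add: disjoint_sum_def)
qed

lemma continuous_map_euclidean_iff:
  fixes f :: "'a \<Rightarrow> 'e::metric_space"
  shows "continuous_map X euclidean f \<longleftrightarrow>
    (\<forall>x\<in>topspace X. \<forall>\<epsilon>>0. \<exists>U. openin X U \<and> x \<in> U \<and> (\<forall>z\<in>U. dist (f x) (f z) < \<epsilon>))"
  using Met_TC.continuous_map_to_metric[of X f] by (auto simp: mtopology_is_euclidean Ball_def)

text \<open>A partial sum differs from the full sum by at most one tail term. The condition
  \<open>tail\<close> is weaker than local finiteness: the terms may accumulate at a point if they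
  shrink uniformly near it.\<close>

lemma continuous_map_disjoint_sum:
  assumes F: "\<And>n. continuous_map X euclidean (F n)"
    and disj: "\<And>x m n. x \<in> topspace X \<Longrightarrow> m \<noteq> n \<Longrightarrow> F m x = 0 \<or> F n x = 0"
    and tail: "\<And>x \<epsilon>. x \<in> topspace X \<Longrightarrow> \<epsilon> > 0 \<Longrightarrow>
      \<exists>U N. openin X U \<and> x \<in> U \<and> (\<forall>n\<ge>N. \<forall>z\<in>U. norm (F n z) < \<epsilon>)"
  shows "continuous_map X euclidean (disjoint_sum F)"
  unfolding continuous_map_euclidean_iff
proof (intro ballI allI impI)
  fix x \<epsilon> assume x: "x \<in> topspace X" and "(\<epsilon>::real) > 0"
  then have e: "\<epsilon> / 3 > 0" by simp
  obtain U N where U: "openin X U" "x \<in> U" "\<And>n z. n \<ge> N \<Longrightarrow> z \<in> U \<Longrightarrow> norm (F n z) < \<epsilon> / 3"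
    using tail[OF x e] by blast
  let ?P = "\<lambda>z. \<Sum>n<N. F n z"
  have "continuous_map X euclidean ?P" by (intro continuous_map_sum F) simp
  then obtain V where V: "openin X V" "x \<in> V" "\<And>z. z \<in> V \<Longrightarrow> dist (?P x) (?P z) < \<epsilon> / 3"
    unfolding continuous_map_euclidean_iff using x e by meson
  have close: "dist (disjoint_sum F z) (?P z) < \<epsilon> / 3" if z: "z \<in> U" for z
  proof -
    have "z \<in> topspace X" using z U(1) openin_subset by blast
    then obtain n where n: "\<And>m. m \<noteq> n \<Longrightarrow> F m z = 0" using disj by metis
    have "?P z = (\<Sum>m<N. if m = n then F n z else 0)" by (rule sum.cong) (auto simp: n)
    then show ?thesis
      using U(3)[of n z] z e disjoint_sum_eq[of n F z, OF n] by (cases "n < N") (auto simp: dist_norm)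
  qed
  have "dist (disjoint_sum F x) (disjoint_sum F z) < \<epsilon>" if "z \<in> U \<inter> V" for z
    using close[of x] close[of z] V(3)[of z] U(2) that
      dist_triangle[of "disjoint_sum F x" "disjoint_sum F z" "?P x"]
      dist_triangle[of "?P x" "disjoint_sum F z" "?P z"]
    by (auto simp: dist_commute)
  then show "\<exists>U. openin X U \<and> x \<in> U \<and> (\<forall>z\<in>U. dist (disjoint_sum F x) (disjoint_sum F z) < \<epsilon>)"
    using U V by (intro exI[of _ "U \<inter> V"]) auto
qed

lemma continuous_map_scaleR:
  fixes f :: "'a \<Rightarrow> 'e::real_normed_vector"
  assumes "continuous_map X euclideanreal a" "continuous_map X euclidean f"
  shows "continuous_map X euclidean (\<lambda>x. a x *\<^sub>R f x)"
proof -
  have "continuous_on UNIV (\<lambda>p::real \<times> 'e. fst p *\<^sub>R snd p)" by (intro continuous_intros)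
  then have "continuous_map (prod_topology euclideanreal euclidean) euclidean (\<lambda>p::real \<times> 'e. fst p *\<^sub>R snd p)"
    by (simp add: euclidean_product_topology)
  moreover have "continuous_map X (prod_topology euclideanreal euclidean) (\<lambda>x. (a x, f x))"
    using assms by (intro continuous_map_pairedI)
  ultimately have "continuous_map X euclidean ((\<lambda>p::real \<times> 'e. fst p *\<^sub>R snd p) \<circ> (\<lambda>x. (a x, f x)))"
    using continuous_map_compose by blast
  then show ?thesis by (simp add: o_def)
qed

lemma continuous_map_compose_real:
  fixes f :: "'a \<Rightarrow> real" and \<phi> :: "real \<Rightarrow> real"
  assumes "continuous_map X euclideanreal f" "continuous_on S \<phi>" "\<And>x. x \<in> topspace X \<Longrightarrow> f x \<in> S"
  shows "continuous_map X euclideanreal (\<lambda>x. \<phi> (f x))"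
proof -
  have "continuous_map X (top_of_set S) f" using assms by (auto simp: continuous_map_in_subtopology)
  then show ?thesis
    using continuous_map_compose[of X "top_of_set S" f euclideanreal \<phi>] assms(2) by (simp add: o_def)
qed

text \<open>The weights grow like the square root of the running maximum of \<open>s\<close>. They
  tend to infinity, yet at an index where \<open>s\<close> equals its running maximum they are of
  order \<open>sqrt (s n)\<close>, far below \<open>s n\<close>.\<close>

lemma ex_slowly_growing_weights:
  fixes s :: "nat \<Rightarrow> real"
  assumes unb: "\<And>C. \<exists>n. s n > C"
  shows "\<exists>c :: nat \<Rightarrow> nat. (\<forall>n. c n > 0) \<and> (\<forall>K::nat. \<exists>N. \<forall>n\<ge>N. c n \<ge> K) \<and> (\<forall>C::real. \<exists>n. s n > C * c n)"
proof -
  define m where "m n = Max (s ` {..n})" for n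
  define c where "c n = nat \<lceil>sqrt (max 0 (m n))\<rceil> + 1" for n
  have le_m: "s k \<le> m n" if "k \<le> n" for k n
    unfolding m_def by (rule Max_ge) (use that in auto)
  have lower: "sqrt (m n) \<le> c n" if "m n \<ge> 0" for n
    using that by (simp add: c_def) (metis add.commute add_increasing le_of_int_ceiling of_nat_nat zero_le_ceiling
        less_le_not_le nle_le real_sqrt_ge_zero zero_le_one dual_order.trans neg_le_0_iff_le of_int_le_iff)
  have upper: "c n \<le> sqrt (m n) + 2" if "m n \<ge> 0" for n
    using that by (simp add: c_def) linarith
  have "\<exists>N. \<forall>n\<ge>N. c n \<ge> K" for K :: nat
  proof -
    obtain k where k: "s k > (real K)\<^sup>2" using unb by blast
    have "c n \<ge> K" if "n \<ge> k" for n
    proof -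
      have "(real K)\<^sup>2 \<le> m n" using k le_m[OF that] by linarith
      then have "real K \<le> sqrt (m n)" "m n \<ge> 0"
        by (auto intro: real_le_rsqrt order_trans[OF zero_le_power2])
      then show ?thesis using lower[of n] by linarith
    qed
    then show ?thesis by blast
  qed
  moreover have "\<exists>n. s n > C * c n" for C :: real
  proof -
    \<comment> \<open>With \<open>r = sqrt (s n)\<close> above \<open>D + 2\<close> one has D(r + 2)
      < (D + 2)r < rr. The maximum with 0 allows the upper bound for \<open>c n\<close> to be
      multiplied by \<open>D\<close>.\<close>
    define D where "D = max C 0"
    obtain k where k: "s k > (D + 2)\<^sup>2" using unb by blast
    have "m k \<in> s ` {..k}" unfolding m_def by (rule Max_in) auto
    then obtain n where n: "n \<le> k" "s n = m k" by auto
    have "m n \<le> m k" unfolding m_def by (rule Max_mono) (use n in auto)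
    then have mn: "m n = s n" using le_m[of n n] n by simp
    have "s n > (D + 2)\<^sup>2" using k n le_m[of k k] by simp
    then have pos: "s n \<ge> 0" and r: "sqrt (s n) > D + 2"
      by (auto intro: real_less_rsqrt order_trans[OF zero_le_power2] less_imp_le)
    have "C * c n \<le> D * (sqrt (s n) + 2)"
      using upper[of n] mn pos by (intro mult_mono) (auto simp: D_def)
    also have "\<dots> < (D + 2) * sqrt (s n)"
    proof -
      have "D * 2 < 2 * sqrt (s n)" using r by linarith
      then show ?thesis by (simp add: algebra_simps)
    qed
    also have "\<dots> \<le> sqrt (s n) * sqrt (s n)"
      using r pos by (intro mult_right_mono) auto
    also have "\<dots> = s n" using pos by simp
    finally show ?thesis by blast
  qed
  moreover have "\<forall>n. c n > 0" by (simp add: c_def)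
  ultimately show ?thesis by (intro exI[of _ c] conjI) simp_all
qed



section \<open>Modules over local rings\<close>

text \<open>Since 1/2 is the cosine of pi/3, the fractional part \<open>r\<close> of
  \<open>w\<close> stays more than 1/6 away from 0 and 1: the cosine decreases on [0, pi], which is
  applied to 2 pi r and, for the upper end, to 2 pi - 2 pi r.\<close>

lemma cos_less_halfD:
  assumes "cos (2 * pi * w) < 1 / 2" "w \<ge> 0"
  obtains n :: nat where "n + 1 / 6 < w" "w < n + 5 / 6"
proof -
  define n where "n = nat \<lfloor>w\<rfloor>"
  define r where "r = w - n"
  have "real n = of_int \<lfloor>w\<rfloor>" using assms(2) by (simp add: n_def)
  then have r: "0 \<le> r" "r < 1" unfolding r_def by linarith+
  have "cos (2 * pi * w) = cos (2 * pi * r + 2 * real n * pi)" by (simp add: r_def algebra_simps)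
  then have c: "cos (2 * pi * r) < cos (pi / 3)"
    using assms(1) unfolding cos_add cos_2npi sin_2npi cos_60 by simp
  have "r > 1 / 6"
  proof (rule ccontr)
    assume "\<not> ?thesis"
    then have "cos (pi / 3) \<le> cos (2 * pi * r)"
      using r by (intro cos_monotone_0_pi_le) auto
    then show False using c by simp
  qed
  moreover have "r < 5 / 6"
  proof (rule ccontr)
    assume "\<not> ?thesis"
    then have "pi * 5 \<le> pi * (r * 6)" by (intro mult_left_mono) auto
    then have "cos (pi / 3) \<le> cos (2 * pi - 2 * pi * r)"
      using r by (intro cos_monotone_0_pi_le) (auto simp: algebra_simps)
    then show False using c by (simp add: cos_diff)
  qed
  ultimately show ?thesis using that[of n] by (simp add: r_def)
qed

section \<open>Locality and rescaling of companions, and the amplification argument\<close>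

context biseparating_pair
begin

lemma companion_local:
  assumes "companion \<omega> \<sigma>" "open J"
  shows "(\<forall>f\<in>M. \<forall>f'\<in>M. (\<forall>x\<in>topspace X. \<omega> x \<in> J \<longrightarrow> f x = f' x) \<longrightarrow>
           (\<forall>y\<in>topspace Y. \<sigma> y \<in> J \<longrightarrow> T f y = T f' y)) \<and>
        (\<forall>g\<in>N. \<forall>g'\<in>N. (\<forall>y\<in>topspace Y. \<sigma> y \<in> J \<longrightarrow> g y = g' y) \<longrightarrow>
           (\<forall>x\<in>topspace X. \<omega> x \<in> J \<longrightarrow> S g x = S g' x))"
proof -
  from assms(1) have "\<forall>J. open J \<longrightarrow>
        (\<forall>f\<in>M. \<forall>f'\<in>M. (\<forall>x\<in>topspace X. \<omega> x \<in> J \<longrightarrow> f x = f' x) \<longrightarrow>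
           (\<forall>y\<in>topspace Y. \<sigma> y \<in> J \<longrightarrow> T f y = T f' y)) \<and>
        (\<forall>g\<in>N. \<forall>g'\<in>N. (\<forall>y\<in>topspace Y. \<sigma> y \<in> J \<longrightarrow> g y = g' y) \<longrightarrow>
           (\<forall>x\<in>topspace X. \<omega> x \<in> J \<longrightarrow> S g x = S g' x))"
    unfolding companion_def by (elim conjE)
  then show ?thesis using assms(2) by (elim allE[of _ J] mp)
qed

lemma companion_T_eq:
  assumes "companion \<omega> \<sigma>" "open J" "f \<in> M" "f' \<in> M"
    and "\<And>x. x \<in> topspace X \<Longrightarrow> \<omega> x \<in> J \<Longrightarrow> f x = f' x" "y \<in> topspace Y" "\<sigma> y \<in> J"
  shows "T f y = T f' y"
  using conjunct1[OF companion_local[OF assms(1,2)]] assms(3-7) by blast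

lemma companion_S_eq:
  assumes "companion \<omega> \<sigma>" "open J" "g \<in> N" "g' \<in> N"
    and "\<And>y. y \<in> topspace Y \<Longrightarrow> \<sigma> y \<in> J \<Longrightarrow> g y = g' y" "x \<in> topspace X" "\<omega> x \<in> J"
  shows "S g x = S g' x"
  using conjunct2[OF companion_local[OF assms(1,2)]] assms(3-7) by blast

lemma companion_dense:
  assumes "companion \<omega> \<sigma>" "openin Y V" "y \<in> V"
  obtains z where "z \<in> V" "0 < \<sigma> z"
proof -
  have "\<forall>V y. openin Y V \<and> y \<in> V \<longrightarrow> (\<exists>z\<in>V. 0 < \<sigma> z)"
    using assms(1) by (simp add: companion_def)
  then show ?thesis using assms(2,3) that by blast
qed

text \<open>Scaling replaces an open set \<open>J\<close> by its preimage under multiplication by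
  \<open>r\<close>. It shifts the annuli, so that a suitable \<open>r\<close> moves the boundaries
  of one family into the interior of another.\<close>

lemma companion_scale:
  assumes c: "companion \<omega> \<sigma>" and r: "0 < r" "r \<le> 1"
  shows "companion (\<lambda>x. r * \<omega> x) (\<lambda>y. r * \<sigma> y)"
  unfolding companion_def
proof (intro conjI allI impI ballI)
  have "continuous_map X euclideanreal \<omega>" "continuous_map Y euclideanreal \<sigma>"
    using c by (simp_all add: companion_def)
  then show "continuous_map X euclideanreal (\<lambda>x. r * \<omega> x)"
    "continuous_map Y euclideanreal (\<lambda>y. r * \<sigma> y)"
    by (auto intro!: continuous_intros)
  show "0 < r * \<omega> x" "r * \<omega> x \<le> 1" if "x \<in> topspace X" for x
    using c r that mult_le_one[of r "\<omega> x"] by (auto simp: companion_def less_imp_le)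
  show "0 \<le> r * \<sigma> y" "r * \<sigma> y \<le> 1" if "y \<in> topspace Y" for y
    using c r that mult_le_one[of r "\<sigma> y"] by (auto simp: companion_def less_imp_le)
  show "\<exists>z\<in>V. 0 < r * \<sigma> z" if V: "openin Y V \<and> y \<in> V" for V y
  proof -
    obtain z where "z \<in> V" "0 < \<sigma> z" using companion_dense[OF c] V by blast
    then show ?thesis using mult_pos_pos[OF r(1)] by blast
  qed
  have J: "open ((*) r -` J)" if "open J" for J
    using that by (intro open_vimage continuous_intros)
  show "T f y = T f' y" if "open J" "f \<in> M" "f' \<in> M"
    "\<forall>x\<in>topspace X. r * \<omega> x \<in> J \<longrightarrow> f x = f' x" "y \<in> topspace Y" "r * \<sigma> y \<in> J" for J f f' y
    by (rule companion_T_eq[OF c J[OF that(1)] that(2,3)]) (use that(4-6) in simp_all)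
  show "S g x = S g' x" if "open J" "g \<in> N" "g' \<in> N"
    "\<forall>y\<in>topspace Y. r * \<sigma> y \<in> J \<longrightarrow> g y = g' y" "x \<in> topspace X" "r * \<omega> x \<in> J" for J g g' x
    by (rule companion_S_eq[OF c J[OF that(1)] that(2,3)]) (use that(4-6) in simp_all)
qed

text \<open>The \<open>n\<close>-th annulus is \<open>n < - ln \<omega> < n + 1\<close>; the bound on the cosine keeps the support of \<open>f\<close>
  away from the boundaries of the annuli.\<close>

lemma T_eq_zero_if_amplified:
  assumes c: "companion \<omega> \<sigma>" and y: "y \<in> topspace Y" "\<sigma> y = 0"
    and f: "f \<in> M" "\<And>x. x \<in> topspace X \<Longrightarrow> f x \<noteq> 0 \<Longrightarrow> cos (2 * pi * ln (\<omega> x)) < 1 / 2"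
    and g: "g \<in> M" "\<And>x. x \<in> topspace X \<Longrightarrow> f x = 0 \<Longrightarrow> g x = 0"
      "\<And>x n. x \<in> topspace X \<Longrightarrow> real n + 1 / 6 \<le> - ln (\<omega> x) \<Longrightarrow> - ln (\<omega> x) \<le> real n + 5 / 6 \<Longrightarrow>
        g x = of_nat n *\<^sub>R f x"
  shows "T f y = 0"
proof (rule ccontr)
  assume "T f y \<noteq> 0"
  define a where "a = norm (T f y) / 2"
  have a: "a > 0" "a < norm (T f y)" using \<open>T f y \<noteq> 0\<close> by (auto simp: a_def)
  obtain K :: nat where K: "K > (norm (T g y) + 1) / a" using reals_Archimedean2 by blast
  have cT: "continuous_map Y euclideanreal (\<lambda>z. norm (T f z))"
    "continuous_map Y euclideanreal (\<lambda>z. norm (T g z))"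
    using Y.cont[OF T_in] f(1) g(1) by (auto intro: continuous_map_norm)
  have c\<sigma>: "continuous_map Y euclideanreal \<sigma>" using c by (simp add: companion_def)
  \<comment> \<open>On this neighbourhood \<open>T f\<close> stays above \<open>a\<close> in norm,
    \<open>T g\<close> stays bounded, and \<sigma> is so small that positive values lie in annuli of
    index at least \<open>K\<close>. The choice of \<open>K\<close> makes this incompatible with
    \<open>T g z = n T f z\<close>.\<close>
  let ?V = "{z \<in> topspace Y. norm (T f z) \<in> {a<..}} \<inter> {z \<in> topspace Y. norm (T g z) \<in> {..<norm (T g y) + 1}}
    \<inter> {z \<in> topspace Y. \<sigma> z \<in> {..<exp (- real K)}}"
  have "openin Y ?V"
    by (intro openin_Int openin_continuous_map_preimage[OF cT(1)] openin_continuous_map_preimage[OF cT(2)]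
        openin_continuous_map_preimage[OF c\<sigma>]) simp_all
  moreover have "y \<in> ?V" using y a by auto
  ultimately obtain z where z: "z \<in> ?V" "0 < \<sigma> z"
    by (rule companion_dense[OF c])
  define w where "w = - ln (\<sigma> z)"
  have "ln (\<sigma> z) < ln (exp (- real K))" using z by (subst ln_less_cancel_iff) auto
  then have w: "w > K" by (simp add: w_def)
  have \<sigma>z: "\<sigma> z = exp (- w)" using z(2) by (simp add: w_def)
  define n where "n = nat \<lfloor>w\<rfloor>"
  have "real n = of_int \<lfloor>w\<rfloor>" using w by (simp add: n_def)
  then have n: "n \<ge> K" "n \<le> w" "w < n + 1" using w by linarith+
  \<comment> \<open>\<open>u\<close> and \<open>v\<close> bound a window around \<open>w\<close> on
    which \<open>g = n f\<close>. If \<open>w\<close> is not an integer, it is the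
    \<open>n\<close>-th annulus; if \<open>w = n\<close>, it extends 1/6 to either side of the
    boundary, where \<open>f\<close> and hence \<open>g\<close> vanish.\<close>
  define u where "u = (if w = n then real n - 1 / 6 else n)"
  define v where "v = (if w = n then real n + 1 / 6 else n + 1)"
  have uv: "u < w" "w < v" using n by (auto simp: u_def v_def)
  have "g x = of_nat n *\<^sub>R f x" if x: "x \<in> topspace X" "\<omega> x \<in> {exp (- v)<..<exp (- u)}" for x
  proof (cases "f x = 0")
    case True
    then show ?thesis using g(2)[OF x(1)] by simp
  next
    case False
    have pos: "0 < \<omega> x" "\<omega> x \<le> 1" using c x(1) by (auto simp: companion_def)
    have "ln (exp (- v)) < ln (\<omega> x)" "ln (\<omega> x) < ln (exp (- u))"
      using x(2) pos by (subst ln_less_cancel_iff; simp)+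
    then have luv: "u < - ln (\<omega> x)" "- ln (\<omega> x) < v" by auto
    have "cos (2 * pi * - ln (\<omega> x)) < 1 / 2"
      using f(2)[OF x(1) False] by simp
    then obtain m :: nat where m: "m + 1 / 6 < - ln (\<omega> x)" "- ln (\<omega> x) < m + 5 / 6"
      by (rule cos_less_halfD) (use pos in auto)
    show ?thesis
    proof (cases "w = n")
      case True
      then have "real m < real n" "real n < real m + 1" using m luv by (auto simp: u_def v_def)
      then have "m < n" "n < m + 1" by linarith+
      then show ?thesis by simp
    next
      case False
      then have "real m < real n + 1" "real n < real m + 1" using m luv by (auto simp: u_def v_def)
      then have "m < n + 1" "n < m + 1" by linarith+
      then have "m = n" by simp
      then show ?thesis using g(3)[OF x(1), of n] m by simp
    qed
  qed
  moreover have "\<sigma> z \<in> {exp (- v)<..<exp (- u)}" using uv by (simp add: \<sigma>z)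
  ultimately have "T g z = T (\<lambda>x. of_nat n *\<^sub>R f x) z"
    using T_of_nat[OF f(1), of n] z by (intro companion_T_eq[OF c open_greaterThanLessThan g(1)]) auto
  then have eq: "norm (T g z) = n * norm (T f z)" using T_of_nat[OF f(1), of n] by simp
  have "norm (T g y) + 1 < K * a" using K a by (simp add: field_simps)
  also have "\<dots> \<le> n * norm (T f z)" using n z a by (intro mult_mono) auto
  finally show False using z eq by simp
qed

text \<open>Every \<open>f\<close> is a sum of two functions to which the preceding vanishing result
  applies, the second after rescaling the companions. So \<open>T f y = 0\<close> for every
  \<open>f\<close>, contradicting surjectivity. The assumption \<open>amplify\<close> isolates what
  modules over local rings provide.\<close>

lemma companion_nonzero_amplifiable:
  assumes amplify: "\<And>\<omega> f. continuous_map X euclideanreal \<omega> \<Longrightarrow>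
      (\<And>x. x \<in> topspace X \<Longrightarrow> 0 < \<omega> x \<and> \<omega> x \<le> 1) \<Longrightarrow> f \<in> M \<Longrightarrow>
      \<exists>g\<in>M. \<forall>x\<in>topspace X. (f x = 0 \<longrightarrow> g x = 0) \<and>
        (\<forall>n. real n + 1 / 6 \<le> - ln (\<omega> x) \<and> - ln (\<omega> x) \<le> real n + 5 / 6 \<longrightarrow> g x = of_nat n *\<^sub>R f x)"
    and c: "companion \<omega> \<sigma>" and y: "y \<in> topspace Y"
  shows "\<sigma> y \<noteq> 0"
proof
  assume 0: "\<sigma> y = 0"
  have vanish: "T f y = 0"
    if c: "companion \<omega> \<sigma>" and 0: "\<sigma> y = 0" and f: "f \<in> M"
      "\<And>x. x \<in> topspace X \<Longrightarrow> f x \<noteq> 0 \<Longrightarrow> cos (2 * pi * ln (\<omega> x)) < 1 / 2" for f \<omega> \<sigma>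
  proof -
    have "continuous_map X euclideanreal \<omega>" "\<And>x. x \<in> topspace X \<Longrightarrow> 0 < \<omega> x \<and> \<omega> x \<le> 1"
      using c by (simp_all add: companion_def)
    from amplify[OF this f(1)] obtain g where g: "g \<in> M" "\<forall>x\<in>topspace X. (f x = 0 \<longrightarrow> g x = 0) \<and>
        (\<forall>n. real n + 1 / 6 \<le> - ln (\<omega> x) \<and> - ln (\<omega> x) \<le> real n + 5 / 6 \<longrightarrow> g x = of_nat n *\<^sub>R f x)"
      by blast
    show ?thesis
      by (rule T_eq_zero_if_amplified[OF c y 0 f g(1)]) (use g(2) in auto)
  qed
  obtain f where f: "f \<in> M" "T f y \<noteq> 0"
    using Y.nonvanishing[OF y] TS S_in by fastforce
  have \<omega>: "continuous_map X euclideanreal \<omega>" "\<And>x. x \<in> topspace X \<Longrightarrow> 0 < \<omega> x"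
    using c by (auto simp: companion_def)
  \<comment> \<open>This function is at least 1 where the cosine is at most 0, and at most 0 where
    the cosine is at least 1/2; hence \<open>f1\<close> keeps \<open>f\<close> on the first set and
    vanishes on the second.\<close>
  have "continuous_on {0<..} (\<lambda>t. 1 - 2 * cos (2 * pi * ln t))"
    by (intro continuous_intros) auto
  then have "continuous_map X euclideanreal (\<lambda>x. 1 - 2 * cos (2 * pi * ln (\<omega> x)))"
    by (rule continuous_map_compose_real[OF \<omega>(1)]) (use \<omega>(2) in auto)
  then obtain K L where KL: "closedin (stone_cech X) K" "closedin (stone_cech X) L" "disjnt K L"
    "\<forall>x\<in>topspace X. (1 \<le> 1 - 2 * cos (2 * pi * ln (\<omega> x)) \<longrightarrow> stone_cech_emb X x \<in> K) \<and>
      (1 - 2 * cos (2 * pi * ln (\<omega> x)) \<le> 0 \<longrightarrow> stone_cech_emb X x \<in> L)"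
    by (rule stone_cech_separation)
  obtain f1 where f1: "f1 \<in> M" and f1x: "\<forall>x\<in>topspace X. (stone_cech_emb X x \<in> K \<longrightarrow> f1 x = f x) \<and>
      (stone_cech_emb X x \<in> L \<longrightarrow> f1 x = 0) \<and> (f x = 0 \<longrightarrow> f1 x = 0)"
    using X.split[OF KL(1-3) f(1)] by blast
  \<comment> \<open>\<open>f - f1\<close> lives where the cosine is positive, and scaling \<open>\<omega>\<close> by \<open>exp (- 1/2)\<close> changes its sign.\<close>
  have "T f1 y = 0"
  proof (rule vanish[OF c 0 f1])
    fix x assume "x \<in> topspace X" "f1 x \<noteq> 0"
    then show "cos (2 * pi * ln (\<omega> x)) < 1 / 2"
      using f1x KL(4) by (cases "cos (2 * pi * ln (\<omega> x)) < 1 / 2") auto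
  qed
  moreover have "T (\<lambda>x. f x - f1 x) y = 0"
  proof (rule vanish[OF companion_scale[OF c, of "exp (- (1 / 2))"] _ X.diff[OF f(1) f1]])
    fix x assume x: "x \<in> topspace X" "f x - f1 x \<noteq> 0"
    then have "cos (2 * pi * ln (\<omega> x)) > 0"
      using f1x KL(4) by (cases "cos (2 * pi * ln (\<omega> x)) > 0") auto
    moreover have "2 * pi * ln (exp (- (1 / 2)) * \<omega> x) = 2 * pi * ln (\<omega> x) - pi"
      using \<omega>(2)[OF x(1)] by (simp add: ln_mult algebra_simps)
    ultimately show "cos (2 * pi * ln (exp (- (1 / 2)) * \<omega> x)) < 1 / 2"
      by (simp add: cos_diff)
  qed (use 0 in auto)
  ultimately show False using f(2) T_diff[OF f(1) f1] by simp
qed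

end


section \<open>Bounded functions with values in infinite-dimensional spaces\<close>

lemma bounded_cont_funsI:
  assumes "continuous_map X euclidean f" "\<And>x. x \<notin> topspace X \<Longrightarrow> f x = 0"
    and "\<And>x. x \<in> topspace X \<Longrightarrow> norm (f x) \<le> C"
  shows "f \<in> bounded_cont_funs X"
  using assms unfolding bounded_cont_funs_def cont_funs_def bounded_iff by auto

text \<open>A trapezoid: 1 on [1/4, 1], 0 outside [1/8, 3/2], linear in between.\<close>

definition bump :: "real \<Rightarrow> real" where
  "bump t = max 0 (min 1 (min (8 * t - 1) (3 - 2 * t)))"

lemma bump_bounds: "0 \<le> bump t" "bump t \<le> 1"
  by (auto simp: bump_def)

lemma bump_eq_1: "1 / 4 \<le> t \<Longrightarrow> t \<le> 1 \<Longrightarrow> bump t = 1"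
  by (simp add: bump_def)

lemma bump_nonzero: "bump t \<noteq> 0 \<Longrightarrow> t \<in> {1 / 8..3 / 2}"
  by (auto simp: bump_def max_def min_def split: if_splits)

text \<open>The factor 16 is the ratio of 8/5 to 1/10, so a change of exponent leaves the interval.
  The open interval is the wider one so that functions can be compared on an open set around each
  closed annulus.\<close>

lemma annuli_disjoint:
  fixes t :: real
  assumes "16 ^ m * t \<in> {1 / 8..3 / 2}" "16 ^ n * t \<in> {1 / 10<..<8 / 5}"
  shows "m = n"
proof (rule ccontr)
  have gap: "16 * (16 ^ i * t) \<le> 16 ^ j * t" if "i < j" "t > 0" for i j :: nat
  proof -
    have "(16::real) ^ Suc i \<le> 16 ^ j" using that by (intro power_increasing) auto
    then have "16 ^ Suc i * t \<le> 16 ^ j * t" using that by (intro mult_right_mono) auto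
    then show ?thesis by simp
  qed
  have "16 ^ m * t > 0" using assms(1) by auto
  then have t: "t > 0" by (simp add: zero_less_mult_iff)
  assume "m \<noteq> n"
  then consider "m < n" | "n < m" by linarith
  then show False
  proof cases
    case 1
    from gap[OF this t] assms show False
      unfolding atLeastAtMost_iff greaterThanLessThan_iff by linarith
  next
    case 2
    from gap[OF this t] assms show False
      unfolding atLeastAtMost_iff greaterThanLessThan_iff by linarith
  qed
qed

lemma ex_annulus:
  fixes t :: real
  assumes "0 < t" "t \<le> 1"
  obtains n where "1 / 16 < 16 ^ n * t" "16 ^ n * t \<le> 1"
proof -
  define m where "m = (LEAST m. 1 < 16 ^ m * t)"
  obtain k where "1 / t < 16 ^ k" using real_arch_pow[of 16 "1 / t"] by auto
  then have "1 < 16 ^ k * t" using assms by (simp add: field_simps)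
  then have m: "1 < 16 ^ m * t" unfolding m_def by (rule LeastI)
  then obtain n where n: "m = Suc n" using assms by (cases m) auto
  then have "\<not> 1 < 16 ^ n * t" unfolding m_def by (metis not_less_Least lessI)
  then show ?thesis using that[of n] m n by simp
qed

text \<open>The annuli accumulate only at 0, so the family is locally finite where \<omega> is
  positive, and smallness of the tail matters at the zeros of \<omega>.\<close>

lemma continuous_map_disjoint_sum_annuli:
  assumes \<omega>: "continuous_map X euclideanreal \<omega>" "\<And>x. x \<in> topspace X \<Longrightarrow> 0 \<le> \<omega> x"
    and F: "\<And>n. continuous_map X euclidean (F n)"
      "\<And>n x. x \<in> topspace X \<Longrightarrow> F n x \<noteq> 0 \<Longrightarrow> 16 ^ n * \<omega> x \<in> {1 / 8..3 / 2}"
    and tail: "\<And>x \<epsilon>. x \<in> topspace X \<Longrightarrow> \<omega> x = 0 \<Longrightarrow> \<epsilon> > 0 \<Longrightarrow>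
      \<exists>N. \<forall>n\<ge>N. \<forall>z\<in>topspace X. norm (F n z) < \<epsilon>"
  shows "continuous_map X euclidean (disjoint_sum F)"
proof (rule continuous_map_disjoint_sum[OF F(1)])
  show "F m x = 0 \<or> F n x = 0" if "x \<in> topspace X" "m \<noteq> n" for x m n
    using F(2)[of x m] F(2)[of x n] annuli_disjoint[of m "\<omega> x" n] that by fastforce
  fix x and \<epsilon> :: real assume x: "x \<in> topspace X" and "\<epsilon> > 0"
  show "\<exists>U N. openin X U \<and> x \<in> U \<and> (\<forall>n\<ge>N. \<forall>z\<in>U. norm (F n z) < \<epsilon>)"
  proof (cases "\<omega> x = 0")
    case True
    then show ?thesis
      using tail[OF x True \<open>\<epsilon> > 0\<close>] x by (intro exI[of _ "topspace X"]) auto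
  next
    case False
    then have pos: "\<omega> x > 0" using \<omega>(2)[OF x] by simp
    \<comment> \<open>With \<open>\<omega> z > \<omega> x / 2\<close> this gives
      \<open>16 ^ n * \<omega> z > 2\<close> for all \<open>n \<ge> N\<close>, beyond the outer
      radius 3/2.\<close>
    obtain N where N: "4 / \<omega> x < 16 ^ N" using real_arch_pow[of 16 "4 / \<omega> x"] by auto
    let ?U = "{z \<in> topspace X. \<omega> z \<in> {\<omega> x / 2<..}}"
    have "F n z = 0" if "n \<ge> N" "z \<in> ?U" for n z
    proof (rule ccontr)
      assume "F n z \<noteq> 0"
      then have "16 ^ n * \<omega> z \<le> 3 / 2" using F(2)[of z n] that by auto
      moreover have "(16::real) ^ N * (\<omega> x / 2) \<le> 16 ^ n * \<omega> z"
        using that pos by (intro mult_mono power_increasing) auto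
      moreover have "16 ^ N * (\<omega> x / 2) > 2" using N pos by (simp add: field_simps)
      ultimately show False by linarith
    qed
    moreover have "openin X ?U" by (rule openin_continuous_map_preimage[OF \<omega>(1)]) simp
    ultimately show ?thesis using \<open>\<epsilon> > 0\<close> x pos by (intro exI[of _ ?U] exI[of _ N]) auto
  qed
qed

section \<open>Gliding hump and interpolation on annuli\<close>

context biseparating_pair
begin

text \<open>The complement of the closed annulus is open, and over it \<open>g\<close> agrees with
  0; by locality \<open>S g\<close> agrees with \<open>S 0 = 0\<close> over it.\<close>

lemma S_zero_off_annulus:
  assumes c: "companion \<omega> \<sigma>" and g: "g \<in> N"
    "\<And>y. y \<in> topspace Y \<Longrightarrow> g y \<noteq> 0 \<Longrightarrow> 16 ^ n * \<sigma> y \<in> {1 / 8..3 / 2}"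
    and x: "x \<in> topspace X" "S g x \<noteq> 0"
  shows "16 ^ n * \<omega> x \<in> {1 / 8..3 / 2}"
proof (rule ccontr)
  interpret swapped: biseparating_pair Y N X M S T by (rule swap)
  let ?J = "(\<lambda>t::real. 16 ^ n * t) -` (- {1 / 8..3 / 2})"
  assume "16 ^ n * \<omega> x \<notin> {1 / 8..3 / 2}"
  then have \<omega>x: "\<omega> x \<in> ?J" by simp
  have "open ?J" by (intro open_vimage continuous_intros)
  then have "S g x = S (\<lambda>y. 0) x"
  proof (rule companion_S_eq[OF c _ g(1) Y.zero _ x(1) \<omega>x])
    show "g y = 0" if "y \<in> topspace Y" "\<sigma> y \<in> ?J" for y
      using g(2)[OF that(1)] that(2) by (rule_tac ccontr) simp
  qed
  then show False using x(2) swapped.T_zero by simp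
qed

text \<open>Gliding hump: if the preimages were not uniformly bounded, dividing them by slowly growing
  weights \<open>w n\<close> would leave them unbounded, although \<open>\<Sum>n. g n / w n\<close> is continuous also where \<open>\<sigma> = 0\<close>.\<close>

lemma bump_preimages_bounded:
  fixes v :: "nat \<Rightarrow> 'f"
  assumes M: "M = bounded_cont_funs X" and N: "N = bounded_cont_funs Y"
    and c: "companion \<omega> \<sigma>" and v: "\<And>n. norm (v n) \<le> 1"
    and g_def: "\<And>n. g n = (\<lambda>y. if y \<in> topspace Y then bump (16 ^ n * \<sigma> y) *\<^sub>R v n else 0)"
    and gN: "\<And>n. g n \<in> N"
  shows "\<exists>C. \<forall>n. \<forall>x\<in>topspace X. norm (S (g n) x) \<le> C"
proof (rule ccontr)
  interpret swapped: biseparating_pair Y N X M S T by (rule swap)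
  assume unb: "\<not> ?thesis"
  have g_supp: "16 ^ n * \<sigma> y \<in> {1 / 8..3 / 2}" if "g n y \<noteq> 0" for n y
    using that bump_nonzero[of "16 ^ n * \<sigma> y"] by (auto simp: g_def split: if_splits)
  have c\<sigma>: "continuous_map Y euclideanreal \<sigma>" "\<And>y. y \<in> topspace Y \<Longrightarrow> 0 \<le> \<sigma> y"
    using c by (simp_all add: companion_def)
  have ne: "topspace X \<noteq> {}" using unb by auto
  have bdd: "bdd_above ((\<lambda>x. norm (S (g n) x)) ` topspace X)" for n
    using S_in[OF gN[of n]] unfolding M bounded_cont_funs_def
    by (auto simp: bounded_iff bdd_above_def)
  define s where "s n = (SUP x\<in>topspace X. norm (S (g n) x))" for n
  have s: "a < s n \<longleftrightarrow> (\<exists>x\<in>topspace X. a < norm (S (g n) x))" for a n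
    unfolding s_def by (rule less_cSUP_iff[OF ne bdd])
  have "\<exists>n. s n > C" for C using unb s by (meson not_le)
  from ex_slowly_growing_weights[OF this] obtain w :: "nat \<Rightarrow> nat" where
    w': "\<forall>n. w n > 0" "\<forall>K::nat. \<exists>N. \<forall>n\<ge>N. w n \<ge> K" "\<forall>C::real. \<exists>n. s n > C * w n"
    by (elim exE conjE) (rule that)
  note w = w'[rule_format]
  \<comment> \<open>The weights are natural numbers, so additivity alone gives
    \<open>S (g n) = w n S (F n)\<close>.\<close>
  define F where "F n y = (1 / w n) *\<^sub>R g n y" for n y
  have F_norm: "norm (F n y) \<le> 1 / w n" for n y
  proof -
    have "norm (g n y) \<le> 1"
      using bump_bounds[of "16 ^ n * \<sigma> y"] v[of n] by (auto simp: g_def intro: mult_le_one)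
    then show ?thesis using w(1)[of n] by (simp add: F_def divide_right_mono)
  qed
  have F_cont: "continuous_map Y euclidean (F n)" for n
    unfolding F_def using Y.cont[OF gN[of n]] by (intro continuous_map_scaleR) simp_all
  have F_le_1: "norm (F n y) \<le> 1" for n y
  proof -
    have "1 / real (w n) \<le> 1" using w(1)[of n] by simp
    then show ?thesis using F_norm[of n y] by linarith
  qed
  have F_supp: "16 ^ n * \<sigma> y \<in> {1 / 8..3 / 2}" if "F n y \<noteq> 0" for n y
    using g_supp[of n y] that by (auto simp: F_def)
  have F_N: "F n \<in> N" for n
    unfolding N by (rule bounded_cont_funsI[OF F_cont _ F_le_1]) (simp add: F_def g_def)
  have F_disj: "F m y = 0" if "F n y \<noteq> 0" "m \<noteq> n" for m n y
    using annuli_disjoint[of m "\<sigma> y" n] F_supp[of n y] F_supp[of m y] that by fastforce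
  have sum_cases: "\<exists>n. disjoint_sum F y = F n y" for y
    using disjoint_sum_eq[of _ F y] F_disj by metis
  \<comment> \<open>Annuli accumulate at the zeros of \<sigma>; continuity there comes from the
    bound \<open>1 / w n\<close>, which tends to 0.\<close>
  have "continuous_map Y euclidean (disjoint_sum F)"
  proof (rule continuous_map_disjoint_sum_annuli[OF c\<sigma> F_cont F_supp])
    fix \<epsilon> :: real assume "\<epsilon> > 0"
    obtain K :: nat where K: "K > 1 / \<epsilon>" using reals_Archimedean2 by blast
    obtain L where L: "\<forall>n\<ge>L. w n \<ge> K" using w(2) by blast
    have "norm (F n z) < \<epsilon>" if "n \<ge> L" for n z
    proof -
      have "1 / \<epsilon> < w n" using K L that by (meson less_le_trans of_nat_le_iff)
      then have "1 / w n < \<epsilon>" using w(1)[of n] \<open>\<epsilon> > 0\<close> by (simp add: field_simps)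
      then show ?thesis using F_norm[of n z] by linarith
    qed
    then show "\<exists>N. \<forall>n\<ge>N. \<forall>z\<in>topspace Y. norm (F n z) < \<epsilon>" by blast
  qed
  moreover have "disjoint_sum F y = 0" if "y \<notin> topspace Y" for y
    using sum_cases[of y] that by (auto simp: F_def g_def)
  moreover have "norm (disjoint_sum F y) \<le> 1" for y
    using sum_cases[of y] F_le_1 by metis
  ultimately have sum_N: "disjoint_sum F \<in> N"
    unfolding N by (rule bounded_cont_funsI)
  have "bounded (S (disjoint_sum F) ` topspace X)"
    using S_in[OF sum_N] by (simp add: M bounded_cont_funs_def)
  then obtain C where C: "\<And>x. x \<in> topspace X \<Longrightarrow> norm (S (disjoint_sum F) x) \<le> C"
    unfolding bounded_iff by blast
  obtain n where "s n > max C 0 * w n" using w(3) by blast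
  then obtain x where x: "x \<in> topspace X" "max C 0 * w n < norm (S (g n) x)" using s by blast
  have "0 \<le> max C 0 * w n" by simp
  then have "0 < norm (S (g n) x)" using x(2) by linarith
  then have "S (g n) x \<noteq> 0" by auto
  then have \<omega>x: "16 ^ n * \<omega> x \<in> {1 / 8..3 / 2}"
    using S_zero_off_annulus[OF c gN g_supp x(1)] by blast
  let ?J = "(\<lambda>t::real. 16 ^ n * t) -` {1 / 10<..<8 / 5}"
  \<comment> \<open>On the widened \<open>n\<close>-th annulus all other terms vanish, so by
    locality the single bound \<open>C\<close> for the preimage of the sum also bounds
    \<open>S (F n) x\<close>.\<close>
  have "S (disjoint_sum F) x = S (F n) x"
  proof (rule companion_S_eq[OF c _ sum_N F_N _ x(1)])
    show "open ?J" by (intro open_vimage continuous_intros)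
    show "\<omega> x \<in> ?J" using \<omega>x by auto
    fix y assume "\<sigma> y \<in> ?J"
    then have "F m y = 0" if "m \<noteq> n" for m
      using annuli_disjoint[of m "\<sigma> y" n] F_supp[of m y] that by fastforce
    then show "disjoint_sum F y = F n y" by (rule disjoint_sum_eq)
  qed
  moreover have "S (g n) x = w n *\<^sub>R S (F n) x"
  proof -
    have "g n = (\<lambda>y. of_nat (w n) *\<^sub>R F n y)" using w(1)[of n] by (simp add: F_def)
    then have "S (g n) = (\<lambda>x. of_nat (w n) *\<^sub>R S (F n) x)"
      using swapped.T_of_nat[OF F_N, of "w n" n] by simp
    then show ?thesis by simp
  qed
  ultimately have "norm (S (g n) x) \<le> w n * C"
    using C[OF x(1)] by (simp add: mult_left_mono)
  also have "\<dots> \<le> max C 0 * w n"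
    unfolding mult.commute[of "real (w n)"] by (intro mult_right_mono) simp_all
  finally show False using x(2) by simp
qed

text \<open>The preimages \<open>S (g n)\<close> are summed on X, where \<omega> has no zeros; the
  sum of the \<open>g n\<close> themselves need not be continuous at zeros of \<sigma>. Over each
  annulus only one preimage survives, and its image is the bump with value
  \<open>v n\<close>.\<close>

lemma ex_interpolating_function:
  fixes v :: "nat \<Rightarrow> 'f"
  assumes M: "M = bounded_cont_funs X" and N: "N = bounded_cont_funs Y"
    and c: "companion \<omega> \<sigma>" and v: "\<And>n. norm (v n) \<le> 1"
  shows "\<exists>f\<in>M. \<forall>n. \<forall>y\<in>topspace Y. 16 ^ n * \<sigma> y \<in> {1 / 4..1} \<longrightarrow> T f y = v n"
proof -
  have c\<sigma>: "continuous_map Y euclideanreal \<sigma>" using c by (simp add: companion_def)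
  have c\<omega>: "continuous_map X euclideanreal \<omega>" "\<And>x. x \<in> topspace X \<Longrightarrow> 0 < \<omega> x"
    using c by (simp_all add: companion_def)
  define g where "g n = (\<lambda>y. if y \<in> topspace Y then bump (16 ^ n * \<sigma> y) *\<^sub>R v n else 0)" for n
  have gN: "g n \<in> N" for n
  proof -
    have "continuous_map Y euclideanreal (\<lambda>y. bump (16 ^ n * \<sigma> y))"
      unfolding bump_def by (intro continuous_intros c\<sigma>)
    then have "continuous_map Y euclidean (\<lambda>y. bump (16 ^ n * \<sigma> y) *\<^sub>R v n)"
      by (intro continuous_map_scaleR) simp_all
    then have "continuous_map Y euclidean (g n)"
      by (rule continuous_map_eq) (simp add: g_def)
    moreover have "g n y = 0" if "y \<notin> topspace Y" for y
      using that by (simp add: g_def)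
    moreover have "norm (g n y) \<le> 1" for y
      using bump_bounds[of "16 ^ n * \<sigma> y"] v[of n] by (auto simp: g_def intro: mult_le_one)
    ultimately show ?thesis
      unfolding N by (rule bounded_cont_funsI)
  qed
  have g_supp: "16 ^ n * \<sigma> y \<in> {1 / 8..3 / 2}" if "g n y \<noteq> 0" for n y
    using that bump_nonzero[of "16 ^ n * \<sigma> y"] by (auto simp: g_def split: if_splits)
  obtain C where C: "\<And>n x. x \<in> topspace X \<Longrightarrow> norm (S (g n) x) \<le> C"
    using bump_preimages_bounded[where v = v and g = g, OF M N c v g_def gN] by blast
  define F where "F n = S (g n)" for n
  have F_M: "F n \<in> M" for n using S_in[OF gN] by (simp add: F_def)
  have F_supp: "16 ^ n * \<omega> x \<in> {1 / 8..3 / 2}" if "x \<in> topspace X" "F n x \<noteq> 0" for n x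
    using S_zero_off_annulus[OF c gN g_supp that(1)] that(2) by (simp add: F_def)
  have F_out: "F n x = 0" if "x \<notin> topspace X" for n x
    using X.outside[OF F_M that] .
  have F_disj: "F m x = 0" if "F n x \<noteq> 0" "m \<noteq> n" for m n x
    using annuli_disjoint[of m "\<omega> x" n] F_supp[of x n] F_supp[of x m] F_out[of x] that by fastforce
  have sum_cases: "\<exists>n. disjoint_sum F x = F n x" for x
    using disjoint_sum_eq[of _ F x] F_disj by metis
  \<comment> \<open>Positivity of \<omega> on X makes the tail condition vacuous.\<close>
  have "continuous_map X euclidean (disjoint_sum F)"
    by (rule continuous_map_disjoint_sum_annuli[OF c\<omega>(1) _ X.cont[OF F_M] F_supp])
       (use c\<omega>(2) in \<open>force+\<close>)
  moreover have "disjoint_sum F x = 0" if "x \<notin> topspace X" for x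
    using sum_cases[of x] F_out[OF that] by metis
  moreover have "norm (disjoint_sum F x) \<le> C" if "x \<in> topspace X" for x
    using sum_cases[of x] C[OF that] by (metis F_def)
  ultimately have sum_M: "disjoint_sum F \<in> M"
    unfolding M by (rule bounded_cont_funsI)
  have "T (disjoint_sum F) y = v n" if y: "y \<in> topspace Y" "16 ^ n * \<sigma> y \<in> {1 / 4..1}" for n y
  proof -
    let ?J = "(\<lambda>t::real. 16 ^ n * t) -` {1 / 10<..<8 / 5}"
    have "T (disjoint_sum F) y = T (F n) y"
    proof (rule companion_T_eq[OF c _ sum_M F_M _ y(1)])
      show "open ?J" by (intro open_vimage continuous_intros)
      show "\<sigma> y \<in> ?J" using y by auto
      fix x assume "x \<in> topspace X" "\<omega> x \<in> ?J"
      then have "F m x = 0" if "m \<noteq> n" for m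
        using annuli_disjoint[of m "\<omega> x" n] F_supp[of x m] that by fastforce
      then show "disjoint_sum F x = F n x" by (rule disjoint_sum_eq)
    qed
    then show ?thesis using TS[OF gN] y bump_eq_1 by (simp add: F_def g_def)
  qed
  then show ?thesis using sum_M by blast
qed

text \<open>Near \<open>y\<close> the function \<open>T f\<close> stays within 1/4 of
  \<open>T f y\<close>, and 1/2-separation allows at most one \<open>v k\<close> that close. Making
  \<sigma> small excludes the \<open>k\<close>-th annulus as well.\<close>

lemma companion_avoids_annuli:
  fixes v :: "nat \<Rightarrow> 'f"
  assumes M: "M = bounded_cont_funs X" and N: "N = bounded_cont_funs Y"
    and c: "companion \<omega> \<sigma>" and v: "\<And>n. norm (v n) \<le> 1"
      "\<And>m n. m \<noteq> n \<Longrightarrow> 1 / 2 \<le> norm (v m - v n)"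
    and y: "y \<in> topspace Y" "\<sigma> y = 0"
  shows "\<exists>V. openin Y V \<and> y \<in> V \<and> (\<forall>z\<in>V. \<forall>n. 16 ^ n * \<sigma> z \<notin> {1 / 4..1})"
proof -
  obtain f where f: "f \<in> M"
      "\<And>n z. z \<in> topspace Y \<Longrightarrow> 16 ^ n * \<sigma> z \<in> {1 / 4..1} \<Longrightarrow> T f z = v n"
    using ex_interpolating_function[where v = v, OF M N c v(1)] by blast
  let ?V = "{z \<in> topspace Y. T f z \<in> ball (T f y) (1 / 4)}"
  have V: "openin Y ?V"
    by (rule openin_continuous_map_preimage[OF Y.cont[OF T_in[OF f(1)]]]) simp
  have near: "norm (v n - T f y) < 1 / 4" if "z \<in> ?V" "16 ^ n * \<sigma> z \<in> {1 / 4..1}" for n z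
    using that f(2)[of z n] by (auto simp: dist_norm norm_minus_commute)
  have uniq: "m = n" if "norm (v m - T f y) < 1 / 4" "norm (v n - T f y) < 1 / 4" for m n
  proof (rule ccontr)
    assume "m \<noteq> n"
    then have "1 / 2 \<le> norm (v m - v n)" by (rule v(2))
    also have "\<dots> \<le> norm (v m - T f y) + norm (v n - T f y)"
      using norm_triangle_ineq4[of "v m - T f y" "v n - T f y"] by simp
    finally show False using that by simp
  qed
  have "continuous_map Y euclideanreal \<sigma>" using c by (simp add: companion_def)
  then have c\<sigma>: "continuous_map Y euclideanreal (\<lambda>z. 16 ^ k * \<sigma> z)" for k :: nat
    by (intro continuous_intros) auto
  \<comment> \<open>If no \<open>v n\<close> is that close to \<open>T f y\<close>, any
    \<open>k\<close> serves.\<close>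
  have "\<exists>k. \<forall>n. norm (v n - T f y) < 1 / 4 \<longrightarrow> n = k" using uniq by metis
  then obtain k where k: "\<And>n. norm (v n - T f y) < 1 / 4 \<Longrightarrow> n = k" by blast
  let ?W = "?V \<inter> {z \<in> topspace Y. 16 ^ k * \<sigma> z \<in> {..<1 / 4}}"
  have "openin Y ?W"
    by (intro openin_Int V openin_continuous_map_preimage[OF c\<sigma>]) simp
  moreover have "y \<in> ?W" using y by auto
  moreover have "16 ^ n * \<sigma> z \<notin> {1 / 4..1}" if "z \<in> ?W" for z n
  proof
    assume *: "16 ^ n * \<sigma> z \<in> {1 / 4..1}"
    then have "n = k" using near[OF _ *] that k by blast
    then show False using * that by auto
  qed
  ultimately show ?thesis by blast
qed

text \<open>The annuli for \<sigma> and those for its quarter together cover (0, 1]. Near a zero of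
  \<sigma> both families would be avoided, contradicting density of the positive values.\<close>

lemma companion_nonzero_bounded:
  fixes v :: "nat \<Rightarrow> 'f"
  assumes M: "M = bounded_cont_funs X" and N: "N = bounded_cont_funs Y"
    and v: "\<And>n. norm (v n) \<le> 1" "\<And>m n. m \<noteq> n \<Longrightarrow> 1 / 2 \<le> norm (v m - v n)"
    and c: "companion \<omega> \<sigma>" and y: "y \<in> topspace Y"
  shows "\<sigma> y \<noteq> 0"
proof
  assume 0: "\<sigma> y = 0"
  have c4: "companion (\<lambda>x. 1 / 4 * \<omega> x) (\<lambda>y. 1 / 4 * \<sigma> y)"
    by (rule companion_scale[OF c]) simp_all
  have 4: "1 / 4 * \<sigma> y = 0" using 0 by simp
  obtain V where V: "openin Y V" "y \<in> V" "\<forall>z\<in>V. \<forall>n. 16 ^ n * \<sigma> z \<notin> {1 / 4..1}"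
    using companion_avoids_annuli[where v = v, OF M N c v y 0] by blast
  obtain W where W: "openin Y W" "y \<in> W" "\<forall>z\<in>W. \<forall>n. 16 ^ n * (1 / 4 * \<sigma> z) \<notin> {1 / 4..1}"
    using companion_avoids_annuli[where v = v, OF M N c4 v y 4] by blast
  have "openin Y (V \<inter> W)" "y \<in> V \<inter> W" using V W by auto
  then obtain z where z: "z \<in> V \<inter> W" "0 < \<sigma> z" by (rule companion_dense[OF c])
  have "z \<in> topspace Y" using z(1) V(1) openin_subset by blast
  then have "\<sigma> z \<le> 1" using c by (simp add: companion_def)
  then obtain n where n: "1 / 16 < 16 ^ n * \<sigma> z" "16 ^ n * \<sigma> z \<le> 1"
    using ex_annulus[OF z(2)] by blast
  \<comment> \<open>The remaining range (1/16, 1/4) is mapped by the factor 4 into (1/4, 1), the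
    annulus of index \<open>n + 1\<close> for the rescaled companion.\<close>
  have "16 ^ n * \<sigma> z < 1 / 4" using V(3) z(1) n by force
  moreover have eq: "16 ^ Suc n * (1 / 4 * \<sigma> z) = 4 * (16 ^ n * \<sigma> z)" by simp
  ultimately have "16 ^ Suc n * (1 / 4 * \<sigma> z) \<in> {1 / 4..1}"
    unfolding eq atLeastAtMost_iff using n by linarith
  then show False using W(3) z(1) by blast
qed

end

section \<open>The two situations\<close>

text \<open>The cut-off is multiplication by a ring element supplied by normality; on X its
  extension takes the values of the element itself.\<close>

lemma splitting_space_module:
  fixes A :: "('a \<Rightarrow> 'k::real_or_complex) set"
  assumes "completely_regular_space X" "normed_space_over smul" "is_subring X A" "is_normal X A"
    "is_module X smul A M" "\<forall>x\<in>topspace X. \<exists>f\<in>M. f x \<noteq> 0"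
  shows "splitting_space X M"
proof
  interpret V: normed_space_over smul by fact
  fix K L f assume KL: "closedin (stone_cech X) K" "closedin (stone_cech X) L" "disjnt K L" and f: "f \<in> M"
  then obtain a where a: "a \<in> A" "\<forall>p\<in>K. beta_extension X a p = Some 1"
      "\<forall>p\<in>L. beta_extension X a p = Some 0"
    using assms(4) unfolding is_normal_def by blast
  have "continuous_map X euclidean a"
    using a(1) assms(3) by (auto simp: is_subring_def cont_funs_def)
  then have "stone_cech_emb X x \<in> K \<Longrightarrow> a x = 1" "stone_cech_emb X x \<in> L \<Longrightarrow> a x = 0"
    if "x \<in> topspace X" for x
    using a(2,3) beta_extension_emb[of X a x] that by auto
  moreover have "(\<lambda>x. smul (a x) (f x)) \<in> M"
    using assms(5) a(1) f by (auto simp: is_module_def)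
  ultimately show "\<exists>g\<in>M. \<forall>x\<in>topspace X. (stone_cech_emb X x \<in> K \<longrightarrow> g x = f x) \<and>
        (stone_cech_emb X x \<in> L \<longrightarrow> g x = 0) \<and> (f x = 0 \<longrightarrow> g x = 0)"
    by (intro bexI[of _ "\<lambda>x. smul (a x) (f x)"]) auto
qed (use assms in \<open>auto simp: is_module_def\<close>)

text \<open>Constants with value \<open>v\<close> give nonvanishing, and a Urysohn factor with
  values in [0, 1] preserves boundedness.\<close>

lemma splitting_space_bounded:
  fixes v :: "'e::real_normed_vector"
  assumes "completely_regular_space X" "v \<noteq> 0"
  shows "splitting_space X (bounded_cont_funs X :: ('a \<Rightarrow> 'e) set)"
proof
  show "(\<lambda>x. 0) \<in> (bounded_cont_funs X :: ('a \<Rightarrow> 'e) set)"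
    by (auto simp: bounded_cont_funs_def cont_funs_def bounded_iff)
next
  fix f g :: "'a \<Rightarrow> 'e" assume "f \<in> bounded_cont_funs X" "g \<in> bounded_cont_funs X"
  then show "(\<lambda>x. f x - g x) \<in> bounded_cont_funs X"
    by (auto simp: bounded_cont_funs_def cont_funs_def intro: continuous_map_diff bounded_minus_comp)
next
  fix x assume "x \<in> topspace X"
  moreover have "continuous_map X euclidean (\<lambda>x. if x \<in> topspace X then v else 0)"
    by (rule continuous_map_eq[of X euclidean "\<lambda>_. v"]) auto
  then have "(\<lambda>x. if x \<in> topspace X then v else 0) \<in> bounded_cont_funs X"
    by (auto simp: bounded_cont_funs_def cont_funs_def bounded_iff)
  ultimately show "\<exists>f\<in>(bounded_cont_funs X :: ('a \<Rightarrow> 'e) set). f x \<noteq> 0"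
    using assms(2) by (intro bexI[of _ "\<lambda>x. if x \<in> topspace X then v else 0"]) auto
next
  fix K L and f :: "'a \<Rightarrow> 'e"
  assume KL: "closedin (stone_cech X) K" "closedin (stone_cech X) L" "disjnt K L"
    and f: "f \<in> bounded_cont_funs X"
  then obtain \<phi> where \<phi>: "continuous_map (stone_cech X) (top_of_set {0..1::real}) \<phi>"
      "\<phi> ` L \<subseteq> {0}" "\<phi> ` K \<subseteq> {1}"
    using Urysohn_lemma[OF normal_space_stone_cech, of X L K 0 1] by (metis disjnt_sym zero_le_one)
  have c: "continuous_map (stone_cech X) euclideanreal \<phi>"
    using \<phi>(1) continuous_map_in_subtopology by blast
  have b: "0 \<le> \<phi> p \<and> \<phi> p \<le> 1" if "p \<in> topspace (stone_cech X)" for p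
    using \<phi>(1) that by (auto simp: continuous_map_in_subtopology)
  let ?g = "\<lambda>x. \<phi> (stone_cech_emb X x) *\<^sub>R f x"
  have "continuous_map X euclidean ?g"
    using continuous_map_compose[OF continuous_stone_cech_emb c] f
    by (intro continuous_map_scaleR) (auto simp: o_def bounded_cont_funs_def cont_funs_def)
  moreover obtain C where C: "\<And>x. x \<in> topspace X \<Longrightarrow> norm (f x) \<le> C"
    using f by (auto simp: bounded_cont_funs_def bounded_iff)
  have "norm (?g x) \<le> C" if "x \<in> topspace X" for x
  proof -
    have "\<bar>\<phi> (stone_cech_emb X x)\<bar> * norm (f x) \<le> 1 * norm (f x)"
      using b[OF stone_cech_emb_in[OF that]] by (intro mult_right_mono) auto
    then show ?thesis using C[OF that] by simp
  qed
  ultimately have "?g \<in> bounded_cont_funs X"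
    using f unfolding bounded_cont_funs_def cont_funs_def bounded_iff by auto
  moreover have "(stone_cech_emb X x \<in> K \<longrightarrow> ?g x = f x) \<and>
        (stone_cech_emb X x \<in> L \<longrightarrow> ?g x = 0) \<and> (f x = 0 \<longrightarrow> ?g x = 0)" for x
    using \<phi>(2,3) by auto
  ultimately show "\<exists>g\<in>bounded_cont_funs X. \<forall>x\<in>topspace X. (stone_cech_emb X x \<in> K \<longrightarrow> g x = f x) \<and>
        (stone_cech_emb X x \<in> L \<longrightarrow> g x = 0) \<and> (f x = 0 \<longrightarrow> g x = 0)"
    by (intro bexI[of _ ?g]) auto
qed (use assms in \<open>auto simp: bounded_cont_funs_def\<close>)

section \<open>From biseparating maps to pairs\<close>

lemma biseparating_pair_inv_into:
  assumes "splitting_space X M" "splitting_space Y N" "biseparating X Y M N T"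
  shows "biseparating_pair X M Y N T (inv_into M T)"
proof -
  interpret X: splitting_space X M by fact
  interpret Y: splitting_space Y N by fact
  have bij: "bij_betw T M N" and T: "separating X Y M N T" and S: "separating Y X N M (inv_into M T)"
    using assms(3) by (auto simp: biseparating_def)
  show ?thesis
  proof
    show "T f \<in> N" if "f \<in> M" for f using T that by (auto simp: separating_def)
    show "inv_into M T g \<in> M" if "g \<in> N" for g using S that by (auto simp: separating_def)
    show "inv_into M T (T f) = f" if "f \<in> M" for f using bij that by (simp add: bij_betw_inv_into_left)
    show "T (inv_into M T g) = g" if "g \<in> N" for g using bij that by (simp add: bij_betw_inv_into_right)
    show "T (\<lambda>x. f x + f' x) = (\<lambda>y. T f y + T f' y)" if "f \<in> M" "f' \<in> M" for f f'
      using T that by (simp add: separating_def)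
    show "inv_into M T (\<lambda>y. g y + g' y) = (\<lambda>x. inv_into M T g x + inv_into M T g' x)"
      if "g \<in> N" "g' \<in> N" for g g'
      using S that by (simp add: separating_def)
    show "T f y = 0 \<or> T f' y = 0" if "f \<in> M" "f' \<in> M" "\<forall>x\<in>topspace X. f x = 0 \<or> f' x = 0"
      "y \<in> topspace Y" for f f' y
    proof -
      have "cozero X f \<inter> cozero X f' = {}" using that(3) by (auto simp: cozero_def)
      then have "cozero Y (T f) \<inter> cozero Y (T f') = {}"
        using T that(1,2) by (simp add: separating_def)
      then show ?thesis using that(4) by (auto simp: cozero_def)
    qed
    show "inv_into M T g x = 0 \<or> inv_into M T g' x = 0"
      if "g \<in> N" "g' \<in> N" "\<forall>y\<in>topspace Y. g y = 0 \<or> g' y = 0" "x \<in> topspace X" for g g' x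
    proof -
      have "cozero Y g \<inter> cozero Y g' = {}" using that(3) by (auto simp: cozero_def)
      then have "cozero X (inv_into M T g) \<inter> cozero X (inv_into M T g') = {}"
        using S that(1,2) by (simp add: separating_def)
      then show ?thesis using that(4) by (auto simp: cozero_def)
    qed
  qed
qed

section \<open>Cut-off multipliers in a local ring\<close>

lemma is_subring_sum:
  assumes A: "is_subring X A" and a: "\<And>n. a n \<in> A"
  shows "(\<lambda>x. \<Sum>n<(N::nat). of_nat n * a n x) \<in> A"
proof -
  have zero: "(\<lambda>x. 0) \<in> A" and diff: "\<And>f g. f \<in> A \<Longrightarrow> g \<in> A \<Longrightarrow> (\<lambda>x. f x - g x) \<in> A"
    using A by (auto simp: is_subring_def)
  have add: "(\<lambda>x. f x + g x) \<in> A" if "f \<in> A" "g \<in> A" for f g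
    using diff[OF that(1) diff[OF zero that(2)]] by simp
  \<comment> \<open>The ring may contain no constants, so natural multiples are formed by repeated
    addition.\<close>
  have mult: "(\<lambda>x. of_nat n * f x) \<in> A" if "f \<in> A" for n f
  proof (induction n)
    case (Suc n)
    then show ?case using add[OF that Suc] by (simp add: algebra_simps)
  qed (simp add: zero)
  show ?thesis
  proof (induction N)
    case (Suc N)
    then show ?case using add[OF Suc mult[OF a[of N], of N]] by simp
  qed (simp add: zero)
qed

text \<open>\<open>g\<close> is \<open>b f\<close>, where \<open>b\<close> is the sum of the
  \<open>n a n\<close> and \<open>a n\<close> is a cut-off to the \<open>n\<close>-th annulus. As
  \<open>- ln \<omega>\<close> is locally bounded, the sum is locally finite, and locality puts the
  possibly unbounded \<open>b\<close> into \<open>A\<close>.\<close>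

lemma amplify_module:
  fixes A :: "('a \<Rightarrow> 'k::real_or_complex) set"
  assumes V: "normed_space_over smul"
    and A: "is_subring X A" "is_normal X A" "is_local X A" and M: "is_module X smul A M"
    and \<omega>: "continuous_map X euclideanreal \<omega>" "\<And>x. x \<in> topspace X \<Longrightarrow> 0 < \<omega> x \<and> \<omega> x \<le> 1"
    and f: "f \<in> M"
  shows "\<exists>g\<in>M. \<forall>x\<in>topspace X. (f x = 0 \<longrightarrow> g x = 0) \<and>
      (\<forall>n. real n + 1 / 6 \<le> - ln (\<omega> x) \<and> - ln (\<omega> x) \<le> real n + 5 / 6 \<longrightarrow> g x = of_nat n *\<^sub>R f x)"
proof -
  interpret V: normed_space_over smul by fact
  define W where "W x = - ln (\<omega> x)" for x
  have "continuous_on {0<..} (\<lambda>t::real. - ln t)" by (intro continuous_intros) auto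
  then have W: "continuous_map X euclideanreal W"
    unfolding W_def by (rule continuous_map_compose_real[OF \<omega>(1)]) (use \<omega>(2) in auto)
  have a_ex: "\<exists>a\<in>A. \<forall>x\<in>topspace X. (n + 1 / 6 \<le> W x \<and> W x \<le> n + 5 / 6 \<longrightarrow> a x = 1) \<and>
      (W x \<le> n \<or> real n + 1 \<le> W x \<longrightarrow> a x = 0)" for n :: nat
  proof -
    \<comment> \<open>The factor 6 makes this at least 1 exactly on [n + 1/6, n + 5/6]; it is at
      most 0 exactly outside the open annulus.\<close>
    have "continuous_map X euclideanreal (\<lambda>x. 6 * min (W x - n) (real n + 1 - W x))"
      by (intro continuous_intros W) auto
    then obtain K L where KL: "closedin (stone_cech X) K" "closedin (stone_cech X) L" "disjnt K L"
      "\<forall>x\<in>topspace X. (1 \<le> 6 * min (W x - n) (real n + 1 - W x) \<longrightarrow> stone_cech_emb X x \<in> K) \<and>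
        (6 * min (W x - n) (real n + 1 - W x) \<le> 0 \<longrightarrow> stone_cech_emb X x \<in> L)"
      by (rule stone_cech_separation)
    then obtain a where a: "a \<in> A" "\<forall>p\<in>K. beta_extension X a p = Some 1"
        "\<forall>p\<in>L. beta_extension X a p = Some 0"
      using A(2) unfolding is_normal_def by blast
    have ca: "continuous_map X euclidean a"
      using a(1) A(1) by (auto simp: is_subring_def cont_funs_def)
    have "(n + 1 / 6 \<le> W x \<and> W x \<le> n + 5 / 6 \<longrightarrow> a x = 1) \<and> (W x \<le> n \<or> real n + 1 \<le> W x \<longrightarrow> a x = 0)"
      if x: "x \<in> topspace X" for x
    proof (intro conjI impI)
      assume "n + 1 / 6 \<le> W x \<and> W x \<le> n + 5 / 6"
      then have "1 \<le> 6 * min (W x - n) (real n + 1 - W x)" by (auto simp: min_def)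
      then have "stone_cech_emb X x \<in> K" using KL(4) x by blast
      then show "a x = 1" using a(2) beta_extension_emb[OF ca x] by simp
    next
      assume "W x \<le> n \<or> real n + 1 \<le> W x"
      then have "6 * min (W x - n) (real n + 1 - W x) \<le> 0" by (auto simp: min_def)
      then have "stone_cech_emb X x \<in> L" using KL(4) x by blast
      then show "a x = 0" using a(3) beta_extension_emb[OF ca x] by simp
    qed
    then show ?thesis using a(1) by blast
  qed
  have "\<exists>a. \<forall>n. a n \<in> A \<and> (\<forall>x\<in>topspace X. (real n + 1 / 6 \<le> W x \<and> W x \<le> n + 5 / 6 \<longrightarrow> a n x = 1) \<and>
      (W x \<le> n \<or> real n + 1 \<le> W x \<longrightarrow> a n x = 0))"
    by (rule choice) (use a_ex in blast)
  then obtain a where aA: "\<And>n. a n \<in> A"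
    and a: "\<And>n x. x \<in> topspace X \<Longrightarrow> real n + 1 / 6 \<le> W x \<Longrightarrow> W x \<le> n + 5 / 6 \<Longrightarrow> a n x = 1"
      "\<And>n x. x \<in> topspace X \<Longrightarrow> W x \<le> real n \<or> real n + 1 \<le> W x \<Longrightarrow> a n x = 0"
    by blast
  have cA: "continuous_map X euclidean (a n)" and oA: "x \<notin> topspace X \<Longrightarrow> a n x = 0" for n x
    using aA[of n] A(1) by (auto simp: is_subring_def cont_funs_def)
  define F where "F n x = of_nat n * a n x" for n x
  have F_unique: "m = n" if "F m x \<noteq> 0" "F n x \<noteq> 0" "x \<in> topspace X" for m n x
  proof -
    have "a m x \<noteq> 0" "a n x \<noteq> 0" using that by (auto simp: F_def)
    then have "real m < W x" "W x < real m + 1" "real n < W x" "W x < real n + 1"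
      using a(2)[OF that(3), of m] a(2)[OF that(3), of n] by force+
    then have "real m < real n + 1" "real n < real m + 1" by linarith+
    then have "m < n + 1" "n < m + 1" by linarith+
    then show ?thesis by simp
  qed
  define b where "b = disjoint_sum F"
  have b_eq: "b x = (\<Sum>n<N. F n x)" if "x \<in> topspace X" "W x \<le> real N" for x N
  proof -
    have F0: "F n x = 0" if "n \<ge> N" for n
      using a(2)[of x n] that \<open>x \<in> topspace X\<close> \<open>W x \<le> real N\<close> by (simp add: F_def)
    have "(\<Sum>n<N. F n x) = (\<Sum>n | F n x \<noteq> 0. F n x)"
      by (rule sum.mono_neutral_right) (use F0 not_less in auto)
    then show ?thesis by (simp add: b_def disjoint_sum_def)
  qed
  have nbhd: "\<exists>U N. openin X U \<and> x \<in> U \<and> (\<forall>z\<in>U. W z \<le> real N)" if x: "x \<in> topspace X" for x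
  proof -
    obtain N :: nat where N: "W x < N" using reals_Archimedean2 by blast
    have "openin X {z \<in> topspace X. W z \<in> {..<real N}}"
      by (rule openin_continuous_map_preimage[OF W]) simp
    then show ?thesis using N x by (intro exI[of _ "{z \<in> topspace X. W z \<in> {..<real N}}"] exI[of _ N]) auto
  qed
  have "continuous_map X euclidean b"
    unfolding b_def
  proof (rule continuous_map_disjoint_sum)
    show "continuous_map X euclidean (F n)" for n
    proof -
      have "continuous_map X euclidean (\<lambda>x. real n *\<^sub>R a n x)"
        by (intro continuous_map_scaleR cA) simp
      then show ?thesis by (simp add: F_def[abs_def] scaleR_conv_of_real)
    qed
    show "F m x = 0 \<or> F n x = 0" if "x \<in> topspace X" "m \<noteq> n" for x m n
      using F_unique that by blast
    fix x and \<epsilon> :: real assume x: "x \<in> topspace X" and "\<epsilon> > 0"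
    obtain U N where U: "openin X U" "x \<in> U" "\<forall>z\<in>U. W z \<le> real N" using nbhd[OF x] by blast
    have "F n z = 0" if "n \<ge> N" "z \<in> U" for n z
    proof -
      have "z \<in> topspace X" "W z \<le> real n" using that U openin_subset by fastforce+
      then show ?thesis using a(2)[of z n] by (simp add: F_def)
    qed
    then show "\<exists>U N. openin X U \<and> x \<in> U \<and> (\<forall>n\<ge>N. \<forall>z\<in>U. norm (F n z) < \<epsilon>)"
      using U \<open>\<epsilon> > 0\<close> by (intro exI[of _ U] exI[of _ N]) simp
  qed
  moreover have "b x = 0" if "x \<notin> topspace X" for x
    using oA[OF that] by (simp add: b_def disjoint_sum_def F_def)
  ultimately have b_cont: "b \<in> cont_funs X" by (simp add: cont_funs_def)
  have "\<exists>U. openin X U \<and> x \<in> U \<and> (\<exists>g\<in>A. \<forall>z\<in>U. b z = g z)" if x: "x \<in> topspace X" for x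
  proof -
    obtain U N where U: "openin X U" "x \<in> U" "\<forall>z\<in>U. W z \<le> real N" using nbhd[OF x] by blast
    \<comment> \<open>On \<open>U\<close> only indices below \<open>N\<close> contribute, so
      \<open>b\<close> agrees there with a finite sum from the ring.\<close>
    have "\<forall>z\<in>U. b z = (\<Sum>n<N. of_nat n * a n z)"
      using b_eq U openin_subset[OF U(1)] by (auto simp: F_def)
    then have "\<exists>g\<in>A. \<forall>z\<in>U. b z = g z"
      by (rule bexI[OF _ is_subring_sum[OF A(1) aA]])
    then show ?thesis using U by blast
  qed
  then have bA: "b \<in> A" using A(3) b_cont unfolding is_local_def by blast
  have "b x = of_nat n" if "x \<in> topspace X" "real n + 1 / 6 \<le> W x" "W x \<le> n + 5 / 6" for n x
  proof -
    have "F m x = 0" if "m \<noteq> n" for m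
    proof -
      have "W x \<le> real m \<or> real m + 1 \<le> W x"
      proof (cases "m < n")
        case True
        then have "real m + 1 \<le> real n" by linarith
        then show ?thesis using \<open>real n + 1 / 6 \<le> W x\<close> by linarith
      next
        case False
        then have "real n + 1 \<le> real m" using \<open>m \<noteq> n\<close> by linarith
        then show ?thesis using \<open>W x \<le> n + 5 / 6\<close> by linarith
      qed
      then show ?thesis using a(2)[OF \<open>x \<in> topspace X\<close>] by (simp add: F_def)
    qed
    then have "b x = F n x" unfolding b_def by (rule disjoint_sum_eq)
    then show ?thesis using a(1)[OF that] by (simp add: F_def)
  qed
  moreover have "smul (of_nat n) u = of_nat n *\<^sub>R u" for n u
    using V.scale_of_real[of "real n" u] by simp
  moreover have "(\<lambda>x. smul (b x) (f x)) \<in> M" using M bA f by (simp add: is_module_def)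
  ultimately show ?thesis
    by (intro bexI[of _ "\<lambda>x. smul (b x) (f x)"]) (auto simp: W_def)
qed

theorem theorem3p4:
  fixes X :: "'a topology" and Y :: "'b topology"
    and scaleE :: "'k::real_or_complex \<Rightarrow> 'e::real_normed_vector \<Rightarrow> 'e"
    and scaleF :: "'k \<Rightarrow> 'f::real_normed_vector \<Rightarrow> 'f"
    and AXE :: "('a \<Rightarrow> 'e) set" and AYF :: "('b \<Rightarrow> 'f) set"
    and T :: "('a \<Rightarrow> 'e) \<Rightarrow> ('b \<Rightarrow> 'f)"
  assumes "completely_regular_space X" and "Hausdorff_space X"
    and "completely_regular_space Y" and "Hausdorff_space Y"
    and "normed_space_over scaleE" and "normed_space_over scaleF"
    and situation:
      "(\<exists>(A :: ('a \<Rightarrow> 'k) set) (B :: ('b \<Rightarrow> 'k) set).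
          is_subring X A \<and> is_normal X A \<and> is_local X A \<and>
          is_subring Y B \<and> is_normal Y B \<and> is_local Y B \<and>
          is_module X scaleE A AXE \<and> is_module Y scaleF B AYF \<and>
          (\<forall>x\<in>topspace X. \<exists>f\<in>AXE. f x \<noteq> 0) \<and>
          (\<forall>y\<in>topspace Y. \<exists>g\<in>AYF. g y \<noteq> 0))
       \<or> (infinite_dimensional scaleE \<and> infinite_dimensional scaleF \<and>
          AXE = bounded_cont_funs X \<and> AYF = bounded_cont_funs Y)"
    and "biseparating X Y AXE AYF T"
  shows "realcompactification X homeomorphic_space realcompactification Y"
  using situation
proof (elim disjE exE conjE)
  fix A :: "('a \<Rightarrow> 'k) set" and B :: "('b \<Rightarrow> 'k) set"
  assume A: "is_subring X A" "is_normal X A" "is_local X A"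
    and B: "is_subring Y B" "is_normal Y B" "is_local Y B"
    and M: "is_module X scaleE A AXE" and N: "is_module Y scaleF B AYF"
    and "\<forall>x\<in>topspace X. \<exists>f\<in>AXE. f x \<noteq> 0" "\<forall>y\<in>topspace Y. \<exists>g\<in>AYF. g y \<noteq> 0"
  then interpret biseparating_pair X AXE Y AYF T "inv_into AXE T"
    using assms by (intro biseparating_pair_inv_into splitting_space_module) auto
  interpret swapped: biseparating_pair Y AYF X AXE "inv_into AXE T" T by (rule swap)
  show ?thesis
  proof (rule realcompactification_homeomorphic)
    show "\<sigma> y \<noteq> 0" if "companion \<omega> \<sigma>" "y \<in> topspace Y" for \<omega> \<sigma> y
      by (rule companion_nonzero_amplifiable[OF _ that]) (rule amplify_module[OF assms(5) A M])
    show "\<sigma> x \<noteq> 0" if "swapped.companion \<omega> \<sigma>" "x \<in> topspace X" for \<omega> \<sigma> x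
      by (rule swapped.companion_nonzero_amplifiable[OF _ that]) (rule amplify_module[OF assms(6) B N])
  qed
next
  assume inf: "infinite_dimensional scaleE" "infinite_dimensional scaleF"
    and M: "AXE = bounded_cont_funs X" and N: "AYF = bounded_cont_funs Y"
  \<comment> \<open>Separated sequences are needed in both spaces: \<open>v\<close> for companions
    of \<open>T\<close>, \<open>u\<close> for those of its inverse.\<close>
  have "span S \<noteq> UNIV" if "finite S" for S :: "'e set"
    using finite_dimensional_if_real_span[OF assms(5) that] inf by blast
  then obtain u :: "nat \<Rightarrow> 'e" where u: "\<And>n. norm (u n) \<le> 1" "\<And>m n. m \<noteq> n \<Longrightarrow> 1 / 2 \<le> norm (u m - u n)"
    using ex_separated_sequence[where 'a = 'e] by blast
  have "span S \<noteq> UNIV" if "finite S" for S :: "'f set"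
    using finite_dimensional_if_real_span[OF assms(6) that] inf by blast
  then obtain v :: "nat \<Rightarrow> 'f" where v: "\<And>n. norm (v n) \<le> 1" "\<And>m n. m \<noteq> n \<Longrightarrow> 1 / 2 \<le> norm (v m - v n)"
    using ex_separated_sequence[where 'a = 'f] by blast
  \<comment> \<open>Nonzero vectors for the constant functions in
    \<open>splitting_space_bounded\<close>.\<close>
  have nz: "u 0 - u 1 \<noteq> 0" "v 0 - v 1 \<noteq> 0" using u(2)[of 0 1] v(2)[of 0 1] by auto
  interpret biseparating_pair X AXE Y AYF T "inv_into AXE T"
    by (rule biseparating_pair_inv_into)
      (use splitting_space_bounded[OF assms(1) nz(1)] splitting_space_bounded[OF assms(3) nz(2)]
        assms(8) M N in simp_all)
  interpret swapped: biseparating_pair Y AYF X AXE "inv_into AXE T" T by (rule swap)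
  show ?thesis
  proof (rule realcompactification_homeomorphic)
    show "\<sigma> y \<noteq> 0" if "companion \<omega> \<sigma>" "y \<in> topspace Y" for \<omega> \<sigma> y
      by (rule companion_nonzero_bounded[where v = v, OF M N v that])
    show "\<sigma> x \<noteq> 0" if "swapped.companion \<omega> \<sigma>" "x \<in> topspace X" for \<omega> \<sigma> x
      by (rule swapped.companion_nonzero_bounded[where v = u, OF N M u that])
  qed
qed

end
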